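(* Let $V:\mathbb{Z}\to\mathbb{R}$ be a bounded real-valued function, let $H$ be the operator $[Hu](n)=u(n+1)+u(n-1)+V(n)u(n)$ on $\ell^2(\mathbb{Z})$, and let $K\ge 4$ be such that $\sigma(H)\subseteq[-K+1,K-1]$. Then there are constants $C,c>0$, depending only on $K$, such that for all integers $N\ge 1$ and all $t>0$, $$P_r(N,t)\le C\left[\exp(-cN)+t^4\int_{-K}^K\left(\max_{0\le n\le N-1}\left\|\Phi\left(n,E+it^{-1}\right)\right\|^2\right)^{-1}dE\right],$$ $$P_l(N,t)\le C\left[\exp(-cN)+t^4\int_{-K}^K\left(\max_{-N+1\le n\le 0}\left\|\Phi\left(n,E+it^{-1}\right)\right\|^2\right)^{-1}dE\right].$$
   Context: $\{\delta_n\}_{n\in\mathbb{Z}}$ is the standard basis of $\ell^2(\mathbb{Z})$ and $\sigma(H)$ is the spectrum of $H$. The outside probabilities are $$P_r(N,t)=\sum_{n\ge N}|\langle e^{-itH}\delta_0,\delta_n\rangle|^2,\qquad P_l(N,t)=\sum_{n\le -N}|\langle e^{-itH}\delta_0,\delta_n\rangle|^2 .$$ For $m\in\mathbb{Z}$ and $z\in\mathbb{C}$ let $T(m,z)=\begin{pmatrix} z-V(m) & -1\\ 1 & 0\end{pmatrix}$. The transfer matrices are $\Phi(n,z)=T(n,z)\cdots T(1,z)$ for $n\ge1$, $\Phi(0,z)=\mathrm{Id}$, and $\Phi(n,z)=[T(n+1,z)]^{-1}\cdots[T(0,z)]^{-1}$ for $n\le-1$. *)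

theory Defs
  imports "HOL-Analysis.Analysis"
begin

section \<open>The Hilbert space of square-summable complex families\<close>

definition square_summable :: "('a \<Rightarrow> complex) \<Rightarrow> bool" where
  "square_summable u \<longleftrightarrow> (\<lambda>n. (cmod (u n))\<^sup>2) summable_on UNIV"

lemma square_summable_zero: "square_summable (\<lambda>n. 0)"
  by (simp add: square_summable_def)

lemma square_summable_mono:
  assumes "square_summable v" "\<And>n. cmod (u n) \<le> cmod (v n)"
  shows "square_summable u"
  unfolding square_summable_def
  by (rule summable_on_comparison_test[OF assms(1)[unfolded square_summable_def]])
     (use assms(2) in \<open>auto intro: power_mono\<close>)

lemma square_summable_mult:
  assumes "square_summable u"
  shows "square_summable (\<lambda>n. c * u n)"
proof -
  have "(\<lambda>n. (cmod c)\<^sup>2 * (cmod (u n))\<^sup>2) summable_on UNIV"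
    using assms unfolding square_summable_def by (rule summable_on_cmult_right)
  then show ?thesis
    by (simp add: square_summable_def norm_mult power_mult_distrib)
qed

lemma cmod_add_square_le: "(cmod (x + y))\<^sup>2 \<le> 2 * (cmod x)\<^sup>2 + 2 * (cmod y)\<^sup>2"
proof -
  have "(cmod (x + y))\<^sup>2 \<le> (cmod x + cmod y)\<^sup>2"
    by (intro power_mono norm_triangle_ineq) auto
  also have "\<dots> \<le> 2 * (cmod x)\<^sup>2 + 2 * (cmod y)\<^sup>2"
    using sum_squares_bound[of "cmod x" "cmod y"] by (simp add: power2_sum)
  finally show ?thesis .
qed

lemma square_summable_add:
  assumes "square_summable u" "square_summable v"
  shows "square_summable (\<lambda>n. u n + v n)"
proof -
  have "(\<lambda>n. 2 * (cmod (u n))\<^sup>2 + 2 * (cmod (v n))\<^sup>2) summable_on UNIV"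
    using assms unfolding square_summable_def
    by (intro summable_on_add summable_on_cmult_right)
  then show ?thesis
    unfolding square_summable_def
    by (rule summable_on_comparison_test) (auto intro: cmod_add_square_le)
qed

lemma square_summable_diff:
  assumes "square_summable u" "square_summable v"
  shows "square_summable (\<lambda>n. u n - v n)"
  using square_summable_add[OF assms(1) square_summable_mult[OF assms(2), of "-1"]] by simp

lemma square_summable_reindex:
  assumes "bij f" "square_summable u"
  shows "square_summable (\<lambda>n. u (f n))"
  using assms summable_on_reindex_bij_betw[of f UNIV UNIV "\<lambda>n. (cmod (u n))\<^sup>2"]
  by (simp add: square_summable_def)

lemma square_summable_inner:
  assumes "square_summable u" "square_summable v"
  shows "(\<lambda>n. inner (u n) (v n)) summable_on UNIV"
proof -
  have "(\<lambda>n. (cmod (u n))\<^sup>2 + (cmod (v n))\<^sup>2) summable_on UNIV"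
    using assms unfolding square_summable_def by (rule summable_on_add)
  then have "(\<lambda>n. norm (inner (u n) (v n))) summable_on UNIV"
  proof (rule summable_on_comparison_test)
    fix n
    have "\<bar>inner (u n) (v n)\<bar> \<le> cmod (u n) * cmod (v n)"
      by (rule Cauchy_Schwarz_ineq2)
    also have "\<dots> \<le> (cmod (u n))\<^sup>2 + (cmod (v n))\<^sup>2"
      using sum_squares_bound[of "cmod (u n)" "cmod (v n)"]
        mult_nonneg_nonneg[OF norm_ge_zero norm_ge_zero, of "u n" "v n"] by linarith
    finally show "norm (inner (u n) (v n)) \<le> (cmod (u n))\<^sup>2 + (cmod (v n))\<^sup>2"
      by simp
  qed simp
  then show ?thesis
    by (rule abs_summable_summable)
qed

typedef 'a ell2 = "{u :: 'a \<Rightarrow> complex. square_summable u}"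
  morphisms ell2_nth Abs_ell2
  using square_summable_zero by blast

setup_lifting type_definition_ell2

lemma square_summable_ell2_nth [simp]: "square_summable (ell2_nth u)"
  using ell2_nth by auto

lemma ell2_eqI: "(\<And>n. ell2_nth u n = ell2_nth v n) \<Longrightarrow> u = v"
  by (metis ell2_nth_inject ext)

instantiation ell2 :: (type) real_inner
begin

lift_definition zero_ell2 :: "'a ell2" is "\<lambda>n. 0"
  by (rule square_summable_zero)
lift_definition plus_ell2 :: "'a ell2 \<Rightarrow> 'a ell2 \<Rightarrow> 'a ell2" is "\<lambda>u v n. u n + v n"
  by (rule square_summable_add)
lift_definition minus_ell2 :: "'a ell2 \<Rightarrow> 'a ell2 \<Rightarrow> 'a ell2" is "\<lambda>u v n. u n - v n"
  by (rule square_summable_diff)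
lift_definition uminus_ell2 :: "'a ell2 \<Rightarrow> 'a ell2" is "\<lambda>u n. - u n"
  by (simp add: square_summable_def)
lift_definition scaleR_ell2 :: "real \<Rightarrow> 'a ell2 \<Rightarrow> 'a ell2" is "\<lambda>r u n. r *\<^sub>R u n"
  by (simp add: scaleR_conv_of_real square_summable_mult)

text \<open>The inner product of the class \<^class>\<open>real_inner\<close> is the real part of the complex one defined
  below; both induce the same norm.\<close>

definition inner_ell2 :: "'a ell2 \<Rightarrow> 'a ell2 \<Rightarrow> real" where
  "inner_ell2 u v = (\<Sum>\<^sub>\<infinity>n. inner (ell2_nth u n) (ell2_nth v n))"
definition norm_ell2 :: "'a ell2 \<Rightarrow> real" where
  "norm_ell2 u = sqrt (\<Sum>\<^sub>\<infinity>n. (cmod (ell2_nth u n))\<^sup>2)"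
definition dist_ell2 :: "'a ell2 \<Rightarrow> 'a ell2 \<Rightarrow> real" where
  "dist_ell2 u v = norm (u - v)"
definition sgn_ell2 :: "'a ell2 \<Rightarrow> 'a ell2" where
  "sgn_ell2 u = inverse (norm u) *\<^sub>R u"
definition uniformity_ell2 :: "('a ell2 \<times> 'a ell2) filter" where
  "uniformity_ell2 = (INF e\<in>{0<..}. principal {(u, v). dist u v < e})"
definition open_ell2 :: "'a ell2 set \<Rightarrow> bool" where
  "open_ell2 U \<longleftrightarrow> (\<forall>x\<in>U. eventually (\<lambda>(x', y). x' = x \<longrightarrow> y \<in> U) uniformity)"

instance
proof
  fix u v w :: "'a ell2" and r s :: real
  show "u + v + w = u + (v + w)" "u + v = v + u" "0 + u = u" "- u + u = 0" "u - v = u + - v"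
    by (rule ell2_eqI, simp add: plus_ell2.rep_eq minus_ell2.rep_eq uminus_ell2.rep_eq
          zero_ell2.rep_eq)+
  show "r *\<^sub>R (u + v) = r *\<^sub>R u + r *\<^sub>R v" "(r + s) *\<^sub>R u = r *\<^sub>R u + s *\<^sub>R u"
    "r *\<^sub>R s *\<^sub>R u = (r * s) *\<^sub>R u" "1 *\<^sub>R u = u"
    by (rule ell2_eqI, simp add: plus_ell2.rep_eq scaleR_ell2.rep_eq algebra_simps)+
  show "sgn u = inverse (norm u) *\<^sub>R u" by (rule sgn_ell2_def)
  show "dist u v = norm (u - v)" by (rule dist_ell2_def)
  show "(uniformity :: ('a ell2 \<times> 'a ell2) filter) = (INF e\<in>{0<..}. principal {(u, v). dist u v < e})"
    by (rule uniformity_ell2_def)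
  show "open U \<longleftrightarrow> (\<forall>x\<in>U. eventually (\<lambda>(x', y). x' = x \<longrightarrow> y \<in> U) uniformity)"
    for U :: "'a ell2 set"
    by (rule open_ell2_def)
  show "inner u v = inner v u"
    by (simp add: inner_ell2_def inner_commute)
  show "inner (u + v) w = inner u w + inner v w"
    by (simp add: inner_ell2_def plus_ell2.rep_eq inner_add_left infsum_add square_summable_inner)
  show "inner (r *\<^sub>R u) v = r * inner u v"
    by (simp add: inner_ell2_def scaleR_ell2.rep_eq infsum_cmult_right square_summable_inner)
  show "0 \<le> inner u u"
    by (simp add: inner_ell2_def infsum_nonneg)
  show "inner u u = 0 \<longleftrightarrow> u = 0"
  proof
    assume "inner u u = 0"
    then have "inner (ell2_nth u n) (ell2_nth u n) = 0" for n
      using nonneg_infsum_le_0D[of "\<lambda>n. inner (ell2_nth u n) (ell2_nth u n)" UNIV n]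
      by (simp add: inner_ell2_def square_summable_inner)
    then show "u = 0"
      by (intro ell2_eqI) (simp add: zero_ell2.rep_eq)
  qed (simp add: inner_ell2_def zero_ell2.rep_eq)
  show "norm u = sqrt (inner u u)"
    by (simp add: norm_ell2_def inner_ell2_def power2_norm_eq_inner)
qed

end

lemma ell2_nth_minus: "ell2_nth (u - v) n = ell2_nth u n - ell2_nth v n"
  by (simp add: minus_ell2.rep_eq)

lemma sum_cmod_square_le_norm:
  assumes "finite F"
  shows "(\<Sum>n\<in>F. (cmod (ell2_nth u n))\<^sup>2) \<le> (norm u)\<^sup>2"
proof -
  have "(\<Sum>n\<in>F. (cmod (ell2_nth u n))\<^sup>2) \<le> (\<Sum>\<^sub>\<infinity>n. (cmod (ell2_nth u n))\<^sup>2)"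
    using assms square_summable_ell2_nth[of u]
    by (intro finite_sum_le_infsum) (auto simp: square_summable_def)
  then show ?thesis
    by (simp add: norm_ell2_def infsum_nonneg)
qed

lemma cmod_ell2_nth_le_norm: "cmod (ell2_nth u n) \<le> norm u"
  by (rule power2_le_imp_le) (use sum_cmod_square_le_norm[of "{n}" u] in simp_all)

instance ell2 :: (type) banach
proof
  fix X :: "nat \<Rightarrow> 'a ell2"
  assume X: "Cauchy X"
  have "Cauchy (\<lambda>k. ell2_nth (X k) n)" for n
  proof (rule metric_CauchyI)
    fix e :: real assume "0 < e"
    then obtain M where M: "\<forall>i\<ge>M. \<forall>j\<ge>M. dist (X i) (X j) < e"
      using X unfolding Cauchy_def by blast
    have "dist (ell2_nth (X i) n) (ell2_nth (X j) n) < e" if "i \<ge> M" "j \<ge> M" for i j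
      using cmod_ell2_nth_le_norm[of "X i - X j" n] M that
      by (fastforce simp: dist_norm ell2_nth_minus)
    then show "\<exists>M. \<forall>i\<ge>M. \<forall>j\<ge>M. dist (ell2_nth (X i) n) (ell2_nth (X j) n) < e"
      by blast
  qed
  then have "\<exists>l. (\<lambda>k. ell2_nth (X k) n) \<longlonglongrightarrow> l" for n
    by (simp add: Cauchy_convergent_iff convergent_def)
  then obtain l where l: "\<And>n. (\<lambda>k. ell2_nth (X k) n) \<longlonglongrightarrow> l n"
    by metis
  have key: "(\<Sum>n\<in>F. (cmod (ell2_nth (X i) n - l n))\<^sup>2) \<le> e\<^sup>2"
    if "finite F" "\<forall>j\<ge>M. dist (X i) (X j) < e" for F i e M
  proof (rule LIMSEQ_le_const2)
    show "(\<lambda>j. \<Sum>n\<in>F. (cmod (ell2_nth (X i) n - ell2_nth (X j) n))\<^sup>2)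
      \<longlonglongrightarrow> (\<Sum>n\<in>F. (cmod (ell2_nth (X i) n - l n))\<^sup>2)"
      by (intro tendsto_intros l)
    have "(\<Sum>n\<in>F. (cmod (ell2_nth (X i) n - ell2_nth (X j) n))\<^sup>2) \<le> e\<^sup>2" if "j \<ge> M" for j
    proof -
      have "(\<Sum>n\<in>F. (cmod (ell2_nth (X i) n - ell2_nth (X j) n))\<^sup>2) \<le> (norm (X i - X j))\<^sup>2"
        using sum_cmod_square_le_norm[OF \<open>finite F\<close>, of "X i - X j"] by (simp add: ell2_nth_minus)
      also have "\<dots> \<le> e\<^sup>2"
        using \<open>\<forall>j\<ge>M. dist (X i) (X j) < e\<close> that by (intro power_mono) (auto simp: dist_norm less_imp_le)
      finally show ?thesis .
    qed
    then show "\<exists>M. \<forall>j\<ge>M. (\<Sum>n\<in>F. (cmod (ell2_nth (X i) n - ell2_nth (X j) n))\<^sup>2) \<le> e\<^sup>2"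
      by blast
  qed
  have ssd: "square_summable (\<lambda>n. ell2_nth (X i) n - l n)" if "\<forall>j\<ge>M. dist (X i) (X j) < e" for i e M
    unfolding square_summable_def
  proof (rule nonneg_bdd_above_summable_on)
    show "bdd_above (sum (\<lambda>n. (cmod (ell2_nth (X i) n - l n))\<^sup>2) ` {F. F \<subseteq> UNIV \<and> finite F})"
      using key that by (intro bdd_aboveI2[where M = "e\<^sup>2"]) blast
  qed simp
  obtain M1 where "\<forall>i\<ge>M1. \<forall>j\<ge>M1. dist (X i) (X j) < 1"
    using X unfolding Cauchy_def by (meson zero_less_one)
  then have "square_summable (\<lambda>n. ell2_nth (X M1) n - l n)"
    by (intro ssd[of M1 M1 1]) auto
  from square_summable_diff[OF square_summable_ell2_nth[of "X M1"] this]
  have "square_summable l" by simp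
  then have L: "ell2_nth (Abs_ell2 l) = l"
    by (simp add: Abs_ell2_inverse)
  have "X \<longlonglongrightarrow> Abs_ell2 l"
  proof (rule metric_LIMSEQ_I)
    fix r :: real assume "0 < r"
    then obtain M where M: "\<forall>i\<ge>M. \<forall>j\<ge>M. dist (X i) (X j) < r / 2"
      using X unfolding Cauchy_def by (meson half_gt_zero)
    have "dist (X i) (Abs_ell2 l) < r" if "i \<ge> M" for i
    proof -
      have *: "\<forall>j\<ge>M. dist (X i) (X j) < r / 2" using M that by blast
      have "(\<Sum>\<^sub>\<infinity>n. (cmod (ell2_nth (X i) n - l n))\<^sup>2) \<le> (r / 2)\<^sup>2"
        using ssd[OF *] key[OF _ *] unfolding square_summable_def
        by (intro infsum_le_finite_sums) auto
      then have "norm (X i - Abs_ell2 l) \<le> r / 2"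
        using \<open>0 < r\<close> unfolding norm_ell2_def ell2_nth_minus L by (intro real_le_lsqrt) auto
      then show ?thesis using \<open>0 < r\<close> by (simp add: dist_norm)
    qed
    then show "\<exists>M. \<forall>i\<ge>M. dist (X i) (Abs_ell2 l) < r" by blast
  qed
  then show "convergent X" by (auto simp: convergent_def)
qed

lift_definition scaleC :: "complex \<Rightarrow> 'a ell2 \<Rightarrow> 'a ell2" (infixr \<open>*\<^sub>C\<close> 75) is "\<lambda>c u n. c * u n"
  by (rule square_summable_mult)

definition cinner :: "'a ell2 \<Rightarrow> 'a ell2 \<Rightarrow> complex" where
  "cinner u v = (\<Sum>\<^sub>\<infinity>n. cnj (ell2_nth u n) * ell2_nth v n)"

lift_definition delta :: "'a \<Rightarrow> 'a ell2" is "\<lambda>k n. if n = k then 1 else 0"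
proof -
  fix k :: 'a
  have "(\<lambda>n. (cmod (if n = k then 1 else 0))\<^sup>2) summable_on {k}"
    by simp
  then have "(\<lambda>n. (cmod (if n = k then 1 else 0))\<^sup>2) summable_on UNIV"
    by (rule summable_on_cong_neutral[THEN iffD1, rotated 3]) auto
  then show "square_summable (\<lambda>n. if n = k then 1 else 0)"
    by (simp add: square_summable_def)
qed


section \<open>Spectrum and exponential of a bounded operator\<close>

text \<open>A complex number belongs to the resolvent set if the shifted operator has a two-sided
  inverse that is bounded and linear; complex linearity of the inverse is part of
  the definition because \<^const>\<open>bounded_linear\<close> only refers to real scalars.\<close>

definition resolvent_set :: "('a ell2 \<Rightarrow> 'a ell2) \<Rightarrow> complex set" where
  "resolvent_set A = {z. \<exists>R. bounded_linear R \<and> (\<forall>c u. R (c *\<^sub>C u) = c *\<^sub>C R u) \<and>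
     (\<forall>u. R (A u - z *\<^sub>C u) = u) \<and> (\<forall>u. A (R u) - z *\<^sub>C R u = u)}"

definition op_spectrum :: "('a ell2 \<Rightarrow> 'a ell2) \<Rightarrow> complex set" where
  "op_spectrum A = - resolvent_set A"

text \<open>The exponential series of an operator, convergent in norm at every vector when the operator
  is bounded.\<close>

definition op_exp :: "('a::real_normed_vector \<Rightarrow> 'a) \<Rightarrow> 'a \<Rightarrow> 'a" where
  "op_exp A u = (\<Sum>k. (A ^^ k) u /\<^sub>R fact k)"

lemma summable_op_exp:
  fixes A :: "'a::banach \<Rightarrow> 'a"
  assumes "bounded_linear A"
  shows "summable (\<lambda>k. (A ^^ k) u /\<^sub>R fact k)"
proof (rule summable_comparison_test')
  have bound: "norm ((A ^^ k) u) \<le> onorm A ^ k * norm u" for k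
  proof (induction k)
    case (Suc k)
    have "norm ((A ^^ Suc k) u) \<le> onorm A * norm ((A ^^ k) u)"
      using onorm[OF assms] by simp
    also have "\<dots> \<le> onorm A * (onorm A ^ k * norm u)"
      by (intro mult_left_mono Suc onorm_pos_le assms)
    finally show ?case by (simp add: mult.assoc)
  qed simp
  show "summable (\<lambda>k. inverse (fact k) * onorm A ^ k * norm u)"
    by (intro summable_mult2 summable_exp)
  show "norm ((A ^^ k) u /\<^sub>R fact k) \<le> inverse (fact k) * onorm A ^ k * norm u" if "k \<ge> 0" for k
    using bound[of k] by (simp add: mult.assoc mult_left_mono)
qed


section \<open>Schroedinger operators and outside probabilities\<close>

text \<open>For unbounded \<open>V\<close> the argument of \<^const>\<open>Abs_ell2\<close> need not be square summable, and the
  definition is meaningful for bounded \<open>V\<close> only.\<close>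

definition schroedinger :: "(int \<Rightarrow> real) \<Rightarrow> int ell2 \<Rightarrow> int ell2" where
  "schroedinger V u = Abs_ell2
     (\<lambda>n. ell2_nth u (n + 1) + ell2_nth u (n - 1) + of_real (V n) * ell2_nth u n)"

lemma ell2_nth_schroedinger:
  assumes "bounded (range V)"
  shows "ell2_nth (schroedinger V u) n =
    ell2_nth u (n + 1) + ell2_nth u (n - 1) + of_real (V n) * ell2_nth u n"
proof -
  obtain B where B: "\<And>n. \<bar>V n\<bar> \<le> B"
    using assms by (auto simp: bounded_iff)
  have "square_summable (\<lambda>n. of_real (V n) * ell2_nth u n)"
    by (rule square_summable_mono[OF square_summable_mult[OF square_summable_ell2_nth[of u],
          of "of_real B"]])
       (use B in \<open>auto simp: norm_mult intro!: mult_right_mono intro: order_trans[OF _ abs_ge_self]\<close>)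
  moreover have "square_summable (\<lambda>n. ell2_nth u (n + 1))"
    by (rule square_summable_reindex[where f = "\<lambda>n. n + 1"])
       (simp_all add: bij_betw_byWitness[where f' = "\<lambda>n. n - 1"])
  moreover have "square_summable (\<lambda>n. ell2_nth u (n - 1))"
    by (rule square_summable_reindex[where f = "\<lambda>n. n - 1"])
       (simp_all add: bij_betw_byWitness[where f' = "\<lambda>n. n + 1"])
  ultimately show ?thesis
    by (simp add: schroedinger_def Abs_ell2_inverse square_summable_add)
qed

definition evolution :: "(int \<Rightarrow> real) \<Rightarrow> real \<Rightarrow> int ell2 \<Rightarrow> int ell2" where
  "evolution V t = op_exp (\<lambda>u. (- \<i> * of_real t) *\<^sub>C schroedinger V u)"

definition prob_right :: "(int \<Rightarrow> real) \<Rightarrow> int \<Rightarrow> real \<Rightarrow> real" where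
  "prob_right V N t = (\<Sum>\<^sub>\<infinity>n\<in>{N..}. (cmod (cinner (evolution V t (delta 0)) (delta n)))\<^sup>2)"

definition prob_left :: "(int \<Rightarrow> real) \<Rightarrow> int \<Rightarrow> real \<Rightarrow> real" where
  "prob_left V N t = (\<Sum>\<^sub>\<infinity>n\<in>{..-N}. (cmod (cinner (evolution V t (delta 0)) (delta n)))\<^sup>2)"


section \<open>Transfer matrices\<close>

definition step_matrix :: "(int \<Rightarrow> real) \<Rightarrow> int \<Rightarrow> complex \<Rightarrow> complex^2^2" where
  "step_matrix V m z = vector [vector [z - of_real (V m), -1], vector [1, 0]]"

primrec transfer_forward :: "(int \<Rightarrow> real) \<Rightarrow> nat \<Rightarrow> complex \<Rightarrow> complex^2^2" where
  "transfer_forward V 0 z = mat 1"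
| "transfer_forward V (Suc k) z = step_matrix V (int k + 1) z ** transfer_forward V k z"

text \<open>The argument \<open>k\<close> of \<open>transfer_backward\<close> stands for the site \<open>- k\<close>, so the factor added in
  passing to site \<open>n = - (k + 1)\<close> has index \<open>n + 1 = - k\<close>.\<close>

primrec transfer_backward :: "(int \<Rightarrow> real) \<Rightarrow> nat \<Rightarrow> complex \<Rightarrow> complex^2^2" where
  "transfer_backward V 0 z = mat 1"
| "transfer_backward V (Suc k) z = matrix_inv (step_matrix V (- int k) z) ** transfer_backward V k z"

definition transfer_matrix :: "(int \<Rightarrow> real) \<Rightarrow> int \<Rightarrow> complex \<Rightarrow> complex^2^2" where
  "transfer_matrix V n z =
     (if n \<ge> 0 then transfer_forward V (nat n) z else transfer_backward V (nat (- n)) z)"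

text \<open>The operator norm with respect to the Euclidean norm.\<close>

definition matrix_norm :: "complex^2^2 \<Rightarrow> real" where
  "matrix_norm A = onorm ((*v) A)"

end

theory Submission
  imports Defs "HOL-Complex_Analysis.Complex_Analysis"
begin

text \<open>Write \<open>exp (-i t H) \<delta>\<^sub>0\<close> as a contour integral of \<open>exp (-i t z) (H - z)\<inverse> \<delta>\<^sub>0\<close> over a rectangle around the
  spectrum whose upper side has height \<open>1 / t\<close> (height \<open>1\<close> if \<open>t < 1\<close>). On the other three sides, at distance at
  least one from the spectrum, a Combes--Thomas estimate gives exponential decay in \<open>N\<close>. On the upper
  side, decouple the lattice at a site \<open>p\<close>: the truncated Green function \<open>f\<close> with \<open>f(p) = 0\<close> has norm at most
  \<open>t\<close>, and beyond \<open>p\<close> the Green function is \<open>f(p \<mp> 1)\<close> times a vector of norm at most \<open>t\<close>. The Wronskian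
  of \<open>f\<close> with the two standard solutions bounds \<open>f(p \<mp> 1)\<close> by \<open>t\<close> divided by the norm of the row of the transfer
  matrix indexed by \<open>p\<close>. Every transfer matrix has two such rows, which yields the factor
  \<open>t\<^sup>4 / \<parallel>\<Phi>(n)\<parallel>\<^sup>2\<close> for each \<open>n\<close>, in particular for the maximising one.\<close>

section \<open>The space of square-summable families\<close>

text \<open>The hypothesis on the spectrum supplies bounded inverses of H - z but no bound on their
  norms. The bound by the inverse distance to [-a, a] is recovered from the quadratic form:
  \<open>inner u (H u)\<close> lies between -a |u|^2 and a |u|^2, and testing (H - z) u against u
  rotated by a suitable phase bounds H - z from below. The height 1 / t balances two effects: |exp
  (-i t z)| = exp (t Im z) stays below e, while the resolvent can be as large as t. For t < 1 a side
  at height 1 is already far from the spectrum, so the exponential term alone suffices. All complex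
  analysis is scalar, one coordinate at a time. Tails are estimated over finite sets of sites with
  bounds independent of the set, and the infinite sum is taken only at the end. Since the evolution
  is defined by a power series, its contour formula is obtained from the integrals of z^k times the
  Green function.\<close>

lemma ell2_nth_plus: "ell2_nth (u + v) n = ell2_nth u n + ell2_nth v n"
  by (simp add: plus_ell2.rep_eq)

lemma ell2_nth_zero: "ell2_nth 0 n = 0"
  by (simp add: zero_ell2.rep_eq)

lemma ell2_nth_scaleC: "ell2_nth (c *\<^sub>C u) n = c * ell2_nth u n"
  by (simp add: scaleC.rep_eq)

lemma ell2_nth_scaleR: "ell2_nth (r *\<^sub>R u) n = r *\<^sub>R ell2_nth u n"
  by (simp add: scaleR_ell2.rep_eq)

lemma ell2_nth_delta: "ell2_nth (delta k) n = (if n = k then 1 else 0)"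
  by (simp add: delta.rep_eq)

lemma ell2_nth_uminus: "ell2_nth (- u) n = - ell2_nth u n"
  by (simp add: uminus_ell2.rep_eq)

lemmas ell2_nth_simps = ell2_nth_plus ell2_nth_minus ell2_nth_zero ell2_nth_scaleC
  ell2_nth_scaleR ell2_nth_delta ell2_nth_uminus

lemma norm_ell2_square: "(norm u)\<^sup>2 = (\<Sum>\<^sub>\<infinity>n. (cmod (ell2_nth u n))\<^sup>2)"
  by (simp add: norm_ell2_def infsum_nonneg)

lemma summable_on_ell2: "(\<lambda>n. (cmod (ell2_nth u n))\<^sup>2) summable_on A"
  using square_summable_ell2_nth[of u] unfolding square_summable_def
  by (rule summable_on_subset_banach) simp

lemma norm_scaleC: "norm (c *\<^sub>C u) = cmod c * norm u"
proof -
  have "(norm (c *\<^sub>C u))\<^sup>2 = (cmod c * norm u)\<^sup>2"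
    by (simp add: norm_ell2_square ell2_nth_scaleC norm_mult power_mult_distrib
        infsum_cmult_right summable_on_ell2)
  then show ?thesis by simp
qed

lemma infsum_delta_square:
  "(\<Sum>\<^sub>\<infinity>n. (cmod (if n = k then c else 0))\<^sup>2) = (cmod c)\<^sup>2"
proof -
  have "(\<Sum>\<^sub>\<infinity>n. (cmod (if n = k then c else 0))\<^sup>2) = (\<Sum>\<^sub>\<infinity>n\<in>{k}. (cmod c)\<^sup>2)"
    by (rule infsum_cong_neutral) auto
  then show ?thesis by simp
qed

lemma norm_delta: "norm (delta k) = 1"
  by (simp add: norm_ell2_def ell2_nth_delta infsum_delta_square)

lemma cinner_delta_right: "cinner u (delta k) = cnj (ell2_nth u k)"
proof -
  have "cinner u (delta k) = (\<Sum>\<^sub>\<infinity>n\<in>{k}. cnj (ell2_nth u k))"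
    unfolding cinner_def ell2_nth_delta by (rule infsum_cong_neutral) auto
  then show ?thesis by simp
qed

lemma inner_delta_right: "inner u (delta k) = Re (ell2_nth u k)"
proof -
  have "inner u (delta k) = (\<Sum>\<^sub>\<infinity>n\<in>{k}. Re (ell2_nth u k))"
    unfolding inner_ell2_def ell2_nth_delta
    by (rule infsum_cong_neutral) (auto simp: inner_complex_def)
  then show ?thesis by simp
qed

lemma scaleC_scaleC: "a *\<^sub>C (b *\<^sub>C u) = (a * b) *\<^sub>C u"
  by (rule ell2_eqI) (simp add: ell2_nth_simps)

lemma scaleC_one: "1 *\<^sub>C u = u"
  by (rule ell2_eqI) (simp add: ell2_nth_simps)

lemma scaleC_zero_right: "c *\<^sub>C 0 = 0"
  by (rule ell2_eqI) (simp add: ell2_nth_simps)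

lemma scaleC_of_real: "of_real r *\<^sub>C u = r *\<^sub>R u"
  by (rule ell2_eqI) (simp add: ell2_nth_simps scaleR_conv_of_real)

lemma scaleC_add_right: "c *\<^sub>C (u + v) = c *\<^sub>C u + c *\<^sub>C v"
  by (rule ell2_eqI) (simp add: ell2_nth_simps algebra_simps)

lemma inner_scaleC_scaleC: "inner (c *\<^sub>C u) (w *\<^sub>C u) = Re (cnj c * w) * (norm u)\<^sup>2"
proof -
  have "inner (c * x) (w * x) = Re (cnj c * w) * (cmod x)\<^sup>2" for x :: complex
    by (simp add: inner_complex_def cmod_power2) (simp add: power2_eq_square algebra_simps)
  then show ?thesis
    by (simp add: inner_ell2_def norm_ell2_square ell2_nth_scaleC infsum_cmult_right summable_on_ell2)
qed

lemma inner_scaleC_left: "inner (c *\<^sub>C u) v = inner u (cnj c *\<^sub>C v)"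
  unfolding inner_ell2_def ell2_nth_scaleC
  by (rule infsum_cong) (simp add: inner_complex_def algebra_simps)

lemma bounded_linear_ell2_nth: "bounded_linear (\<lambda>u. ell2_nth u n)"
  by (rule bounded_linear_intro[where K = 1]) (simp_all add: ell2_nth_simps cmod_ell2_nth_le_norm)

text \<open>Both shifts preserve the norm, and (x + y)^2 <= 2 x^2 + 2 y^2 gives 4 c^2 in total. Used
  with c = 1 for the hopping part of the operator and with c = 1/4 for the error term in the
  Combes-Thomas estimate.\<close>

lemma norm_ell2_le_neighbours:
  fixes u v :: "int ell2"
  assumes "\<And>n. cmod (ell2_nth v n) \<le> c * (cmod (ell2_nth u (n + 1)) + cmod (ell2_nth u (n - 1)))"
    and "c \<ge> 0"
  shows "norm v \<le> 2 * c * norm u"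
proof -
  let ?f = "\<lambda>n. (cmod (ell2_nth u n))\<^sup>2"
  have bij: "bij (\<lambda>n::int. n + 1)" "bij (\<lambda>n::int. n - 1)"
    by (rule bij_betw_byWitness[where f' = "\<lambda>n. n - 1"]; simp)
       (rule bij_betw_byWitness[where f' = "\<lambda>n. n + 1"]; simp)
  have s: "(\<lambda>n. ?f (n + 1)) summable_on UNIV" "(\<lambda>n. ?f (n - 1)) summable_on UNIV"
    using summable_on_reindex_bij_betw[OF bij(1), of ?f] summable_on_reindex_bij_betw[OF bij(2), of ?f]
    by (simp_all add: summable_on_ell2)
  have e: "(\<Sum>\<^sub>\<infinity>n. ?f (n + 1)) = (norm u)\<^sup>2" "(\<Sum>\<^sub>\<infinity>n. ?f (n - 1)) = (norm u)\<^sup>2"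
    using infsum_reindex_bij_betw[OF bij(1), of ?f] infsum_reindex_bij_betw[OF bij(2), of ?f]
    by (simp_all add: norm_ell2_square)
  have "(norm v)\<^sup>2 \<le> (\<Sum>\<^sub>\<infinity>n. 2 * c\<^sup>2 * (?f (n + 1) + ?f (n - 1)))"
    unfolding norm_ell2_square
  proof (rule infsum_mono)
    show "(\<lambda>n. 2 * c\<^sup>2 * (?f (n + 1) + ?f (n - 1))) summable_on UNIV"
      by (intro summable_on_cmult_right summable_on_add s)
    fix n
    have "(cmod (ell2_nth v n))\<^sup>2 \<le> (c * (cmod (ell2_nth u (n + 1)) + cmod (ell2_nth u (n - 1))))\<^sup>2"
      using assms by (intro power_mono) auto
    also have "\<dots> \<le> c\<^sup>2 * (2 * ?f (n + 1) + 2 * ?f (n - 1))"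
      unfolding power_mult_distrib
      using sum_squares_bound[of "cmod (ell2_nth u (n + 1))" "cmod (ell2_nth u (n - 1))"]
      by (intro mult_left_mono) (auto simp: power2_sum)
    finally show "(cmod (ell2_nth v n))\<^sup>2 \<le> 2 * c\<^sup>2 * (?f (n + 1) + ?f (n - 1))"
      by (simp add: algebra_simps)
  qed (rule summable_on_ell2)
  also have "\<dots> = (2 * c * norm u)\<^sup>2"
    by (simp add: infsum_cmult_right infsum_add s e summable_on_add power_mult_distrib)
  finally show ?thesis
    by (rule power2_le_imp_le) (use assms in auto)
qed

section \<open>The Schroedinger operator\<close>

lemma square_summable_bounded_mult:
  assumes "bounded (range V)"
  shows "square_summable (\<lambda>n. complex_of_real (V n) * ell2_nth u n)"
proof -
  obtain B where B: "\<And>n. \<bar>V n\<bar> \<le> B"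
    using assms by (auto simp: bounded_iff)
  show ?thesis
    by (rule square_summable_mono[OF square_summable_mult[OF square_summable_ell2_nth[of u],
          of "of_real B"]])
       (use B in \<open>auto simp: norm_mult intro!: mult_right_mono intro: order_trans[OF _ abs_ge_self]\<close>)
qed

lemma bounded_linear_schroedinger:
  assumes "bounded (range V)"
  shows "bounded_linear (schroedinger V)"
proof -
  obtain B where B: "\<And>n. \<bar>V n\<bar> \<le> B"
    using assms by (auto simp: bounded_iff)
  show ?thesis
  proof (rule bounded_linear_intro)
    fix u v :: "int ell2" and r :: real
    show "schroedinger V (u + v) = schroedinger V u + schroedinger V v"
      "schroedinger V (r *\<^sub>R u) = r *\<^sub>R schroedinger V u"
      by (rule ell2_eqI, simp add: ell2_nth_simps ell2_nth_schroedinger[OF assms] algebra_simps)+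
    \<comment> \<open>The potential part; the remainder \<open>schroedinger V u - D\<close> is pure
      hopping, of norm at most 2.\<close>
    define D where "D = Abs_ell2 (\<lambda>n. complex_of_real (V n) * ell2_nth u n)"
    have "square_summable (\<lambda>n. complex_of_real (V n) * ell2_nth u n)"
      by (rule square_summable_bounded_mult[OF assms])
    then have D: "ell2_nth D n = of_real (V n) * ell2_nth u n" for n
      by (simp add: D_def Abs_ell2_inverse)
    have "norm D \<le> B * norm u"
    proof -
      have "(norm D)\<^sup>2 \<le> (\<Sum>\<^sub>\<infinity>n. B\<^sup>2 * (cmod (ell2_nth u n))\<^sup>2)"
        unfolding norm_ell2_square D
      proof (rule infsum_mono)
        show "(\<lambda>n. (cmod (of_real (V n) * ell2_nth u n))\<^sup>2) summable_on UNIV"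
          using summable_on_ell2[of D] by (simp add: D)
        show "(cmod (of_real (V n) * ell2_nth u n))\<^sup>2 \<le> B\<^sup>2 * (cmod (ell2_nth u n))\<^sup>2" for n
          using power_mono[OF B[of n], of 2]
          by (simp add: norm_mult power_mult_distrib mult_right_mono)
      qed (intro summable_on_cmult_right summable_on_ell2)
      also have "\<dots> = (B * norm u)\<^sup>2"
        by (simp add: infsum_cmult_right summable_on_ell2 norm_ell2_square power_mult_distrib)
      finally show ?thesis
        by (rule power2_le_imp_le) (use B[of 0] in auto)
    qed
    moreover have "norm (schroedinger V u - D) \<le> 2 * 1 * norm u"
      by (rule norm_ell2_le_neighbours)
         (simp_all add: ell2_nth_simps ell2_nth_schroedinger[OF assms] D norm_triangle_ineq)
    ultimately have "norm (schroedinger V u) \<le> B * norm u + 2 * norm u"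
      using norm_triangle_ineq[of D "schroedinger V u - D"] by simp
    then show "norm (schroedinger V u) \<le> norm u * (B + 2)"
      by (simp add: algebra_simps)
  qed
qed

lemma schroedinger_scaleC:
  assumes "bounded (range V)"
  shows "schroedinger V (c *\<^sub>C u) = c *\<^sub>C schroedinger V u"
  by (rule ell2_eqI) (simp add: ell2_nth_simps ell2_nth_schroedinger[OF assms] algebra_simps)

lemma square_summable_shift:
  "square_summable (\<lambda>n. ell2_nth u (n + 1 :: int))" "square_summable (\<lambda>n. ell2_nth u (n - 1 :: int))"
proof -
  show "square_summable (\<lambda>n. ell2_nth u (n + 1 :: int))"
    by (rule square_summable_reindex[where f = "\<lambda>n. n + 1"])
       (simp_all add: bij_betw_byWitness[where f' = "\<lambda>n. n - 1"])
  show "square_summable (\<lambda>n. ell2_nth u (n - 1 :: int))"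
    by (rule square_summable_reindex[where f = "\<lambda>n. n - 1"])
       (simp_all add: bij_betw_byWitness[where f' = "\<lambda>n. n + 1"])
qed

section \<open>Symmetry and the numerical range\<close>

lemma schroedinger_symmetric:
  assumes "bounded (range V)"
  shows "inner (schroedinger V u) v = inner u (schroedinger V v)"
proof -
  let ?u = "ell2_nth u" and ?v = "ell2_nth v"
  have ss: "(\<lambda>n. inner (?u (n + 1)) (?v n)) summable_on UNIV"
    "(\<lambda>n. inner (?u (n - 1)) (?v n)) summable_on UNIV"
    "(\<lambda>n. inner (?u n) (?v (n + 1))) summable_on UNIV"
    "(\<lambda>n. inner (?u n) (?v (n - 1))) summable_on UNIV"
    by (intro square_summable_inner square_summable_shift square_summable_ell2_nth)+
  have sh: "(\<lambda>n. inner (of_real (V n) * ?u n) (?v n)) summable_on UNIV"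
  proof -
    have "square_summable (\<lambda>n. of_real (V n) * ?u n)"
      by (rule square_summable_bounded_mult[OF assms])
    then show ?thesis
      by (rule square_summable_inner) simp
  qed
  have sh': "(\<lambda>n. inner (?u n) (of_real (V n) * ?v n)) = (\<lambda>n. inner (of_real (V n) * ?u n) (?v n))"
    by (simp add: inner_complex_def algebra_simps)
  have "(\<Sum>\<^sub>\<infinity>n. inner (?u (n + 1)) (?v n)) = (\<Sum>\<^sub>\<infinity>n. inner (?u n) (?v (n - 1)))"
    using infsum_reindex_bij_betw[of "\<lambda>n::int. n + 1" UNIV UNIV "\<lambda>n. inner (?u n) (?v (n - 1))"]
    by (simp add: bij_betw_byWitness[where f' = "\<lambda>n. n - 1"])
  moreover have "(\<Sum>\<^sub>\<infinity>n. inner (?u (n - 1)) (?v n)) = (\<Sum>\<^sub>\<infinity>n. inner (?u n) (?v (n + 1)))"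
    using infsum_reindex_bij_betw[of "\<lambda>n::int. n - 1" UNIV UNIV "\<lambda>n. inner (?u n) (?v (n + 1))"]
    by (simp add: bij_betw_byWitness[where f' = "\<lambda>n. n + 1"])
  ultimately show ?thesis
    by (simp add: inner_ell2_def ell2_nth_schroedinger[OF assms] inner_add_left inner_add_right
        infsum_add ss sh sh' summable_on_add)
qed

text \<open>The complex quadratic form <u, H u> is real. \<open>inner\<close> sees only real parts,
  so this is proved by showing that the test against \<i> u equals its own negative: multiplication
  by \<i> commutes with H and is skew.\<close>

lemma schroedinger_inner_scaleC:
  assumes "bounded (range V)"
  shows "inner (c *\<^sub>C u) (schroedinger V u) = Re c * inner u (schroedinger V u)"
proof -
  have *: "inner (\<i> *\<^sub>C u) (schroedinger V u) = 0"
  proof -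
    have "inner (\<i> *\<^sub>C u) (schroedinger V u) = inner (\<i> *\<^sub>C schroedinger V u) u"
      by (metis assms schroedinger_scaleC schroedinger_symmetric)
    also have "\<dots> = - inner (\<i> *\<^sub>C u) (schroedinger V u)"
      unfolding inner_scaleC_left[of \<i> u] inner_commute[of _ u]
      by (simp add: inner_ell2_def ell2_nth_scaleC inner_complex_def flip: infsum_uminus)
    finally show ?thesis by simp
  qed
  have "c *\<^sub>C u = Re c *\<^sub>R u + Im c *\<^sub>R (\<i> *\<^sub>C u)"
    by (rule ell2_eqI) (simp add: ell2_nth_simps complex_eq_iff)
  then show ?thesis
    by (simp add: inner_add_left *)
qed

text \<open>Testing \<open>M - A \<ge> 0\<close>, where \<open>M\<close> is the supremum of the numerical range, on the vector
  \<open>u - (M - A) u / L\<close> shows that \<open>(M - A) u\<close> is small when \<open>inner u (A u)\<close> is close to \<open>M\<close>, so that \<open>M\<close> is an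
  approximate eigenvalue.\<close>

lemma numerical_range_le:
  fixes A :: "'a::real_inner \<Rightarrow> 'a"
  assumes A: "bounded_linear A" and sym: "\<And>u v. inner (A u) v = inner u (A v)"
    and below: "\<And>M. M > a \<Longrightarrow> \<exists>B. \<forall>u. norm u \<le> B * norm (A u - M *\<^sub>R u)"
  shows "inner u (A u) \<le> a * (norm u)\<^sup>2"
proof (rule ccontr)
  assume neg: "\<not> inner u (A u) \<le> a * (norm u)\<^sup>2"
  interpret A: bounded_linear A by fact
  have u: "u \<noteq> 0" using neg by (auto simp: A.zero)
  define Q where "Q = {inner x (A x) | x. norm x = 1}"
  have bdd: "bdd_above Q"
  proof (rule bdd_aboveI)
    fix q assume "q \<in> Q"
    then obtain x where x: "norm x = 1" "q = inner x (A x)" by (auto simp: Q_def)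
    have "q \<le> norm x * norm (A x)" unfolding x(2) by (rule norm_cauchy_schwarz)
    also have "\<dots> \<le> onorm A" using onorm[OF A, of x] x by simp
    finally show "q \<le> onorm A" .
  qed
  define M where "M = Sup Q"
  have leM: "inner x (A x) \<le> M * (norm x)\<^sup>2" for x
  proof (cases "x = 0")
    case False
    have "inner (sgn x) (A (sgn x)) \<in> Q"
      using False by (auto simp: Q_def norm_sgn intro!: exI[of _ "sgn x"])
    then have "inner (sgn x) (A (sgn x)) \<le> M"
      unfolding M_def by (rule cSup_upper[OF _ bdd])
    then show ?thesis
      using False by (simp add: sgn_div_norm A.scaleR field_simps power2_eq_square)
  qed (simp add: A.zero)
  have "a < M"
    using neg leM[of u] u by (smt (verit) mult_right_mono zero_le_power2)
  \<comment> \<open>By assumption \<open>A - M\<close> is bounded below at the supremum M itself;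
    the rest shows that this cannot be.\<close>
  then obtain B where B: "\<And>u. norm u \<le> B * norm (A u - M *\<^sub>R u)"
    using below by metis
  define T where "T x = M *\<^sub>R x - A x" for x
  have T: "bounded_linear T"
    unfolding T_def by (intro bounded_linear_sub bounded_linear_scaleR_right A)
  interpret T: bounded_linear T by fact
  have Tsym: "inner (T x) y = inner x (T y)" for x y
    by (simp add: T_def inner_diff_left inner_diff_right sym)
  have Tpos: "inner x (T x) \<ge> 0" for x
    using leM[of x] by (simp add: T_def inner_diff_right power2_norm_eq_inner)
  \<comment> \<open>The summand 1 keeps L positive even if T = 0.\<close>
  define L where "L = onorm T + 1"
  have L: "L > 0" using onorm_pos_le[OF T] by (simp add: L_def)
  have TL: "norm (T x) \<le> L * norm x" for x
    unfolding L_def by (rule order_trans[OF onorm[OF T]]) (simp add: algebra_simps)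
  have small: "(norm (T x))\<^sup>2 \<le> L * inner x (T x)" for x
  proof -
    have "0 \<le> inner (x - (1 / L) *\<^sub>R T x) (T (x - (1 / L) *\<^sub>R T x))" by (rule Tpos)
    also have "\<dots> = inner x (T x) - 2 / L * (norm (T x))\<^sup>2 + 1 / L\<^sup>2 * inner (T x) (T (T x))"
      unfolding power2_norm_eq_inner
      by (simp add: T.diff T.scaleR inner_diff_left inner_diff_right Tsym
          power2_eq_square algebra_simps)
    also have "inner (T x) (T (T x)) \<le> norm (T x) * norm (T (T x))"
      by (rule norm_cauchy_schwarz)
    also have "\<dots> \<le> norm (T x) * (L * norm (T x))"
      by (intro mult_left_mono TL) simp
    finally show ?thesis
      using L by (simp add: field_simps power2_eq_square)
  qed
  have B0: "B > 0"
  proof (rule ccontr)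
    assume "\<not> B > 0"
    then have "B * norm (A u - M *\<^sub>R u) \<le> 0" by (simp add: mult_nonpos_nonneg)
    then show False using B[of u] u by (smt (verit) zero_less_norm_iff)
  qed
  \<comment> \<open>Each unit vector satisfies 1 <= |B T x|^2 <= B^2 L (M - q), so all of Q stays a
    fixed distance below its own supremum.\<close>
  have "M \<le> M - 1 / (B\<^sup>2 * L)"
    unfolding M_def
  proof (rule cSup_least)
    show "Q \<noteq> {}" using u by (auto simp: Q_def intro!: exI[of _ "sgn u"] norm_sgn simp: norm_sgn)
    fix q assume "q \<in> Q"
    then obtain x where x: "norm x = 1" "q = inner x (A x)" by (auto simp: Q_def)
    have "1 \<le> (B * norm (T x))\<^sup>2"
      using B[of x] x(1) by (simp add: T_def norm_minus_commute one_le_power)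
    also have "\<dots> \<le> B\<^sup>2 * (L * inner x (T x))"
      unfolding power_mult_distrib by (intro mult_left_mono small) simp
    also have "inner x (T x) = M - q"
      using x by (simp add: T_def inner_diff_right flip: power2_norm_eq_inner)
    finally show "q \<le> Sup Q - 1 / (B\<^sup>2 * L)"
      using B0 L by (simp add: field_simps M_def)
  qed
  moreover have "1 / (B\<^sup>2 * L) > 0" using B0 L by simp
  ultimately show False by linarith
qed

text \<open>The one-sided bound is applied to H and to -H. A real M outside [-a, a] lies in the
  resolvent set, and the norm of the inverse there serves as the constant B.\<close>

lemma schroedinger_numerical_range:
  assumes V: "bounded (range V)"
    and spec: "op_spectrum (schroedinger V) \<subseteq> complex_of_real ` {-a..a}"
  shows "\<bar>inner u (schroedinger V u)\<bar> \<le> a * (norm u)\<^sup>2"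
proof -
  have ex: "\<exists>B. \<forall>u. norm u \<le> B * norm (schroedinger V u - M *\<^sub>R u)" if "\<bar>M\<bar> > a" for M
  proof -
    have "complex_of_real M \<notin> op_spectrum (schroedinger V)"
    proof
      assume "complex_of_real M \<in> op_spectrum (schroedinger V)"
      then obtain r where "complex_of_real M = complex_of_real r" "r \<in> {-a..a}"
        using spec by blast
      then show False using that by (auto simp: abs_if split: if_splits)
    qed
    then obtain R where R: "bounded_linear R" "\<And>u. R (schroedinger V u - of_real M *\<^sub>C u) = u"
      by (auto simp: op_spectrum_def resolvent_set_def)
    have "norm u \<le> onorm R * norm (schroedinger V u - M *\<^sub>R u)" for u
      using onorm[OF R(1), of "schroedinger V u - M *\<^sub>R u"] R(2)[of u] by (simp add: scaleC_of_real)
    then show ?thesis by blast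
  qed
  have "inner u (schroedinger V u) \<le> a * (norm u)\<^sup>2"
    by (rule numerical_range_le)
       (use V ex in \<open>auto simp: bounded_linear_schroedinger schroedinger_symmetric\<close>)
  moreover have "inner u (- schroedinger V u) \<le> a * (norm u)\<^sup>2"
  proof (rule numerical_range_le)
    show "bounded_linear (\<lambda>u. - schroedinger V u)"
      using V by (intro bounded_linear_minus bounded_linear_schroedinger)
    show "\<exists>B. \<forall>u. norm u \<le> B * norm (- schroedinger V u - M *\<^sub>R u)" if "M > a" for M
    proof -
      have "norm (- schroedinger V u - M *\<^sub>R u) = norm (schroedinger V u - (- M) *\<^sub>R u)" for u
        using norm_minus_cancel[of "schroedinger V u - (- M) *\<^sub>R u"] by simp
      then show ?thesis using ex[of "- M"] that by simp
    qed
  qed (simp add: V schroedinger_symmetric)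
  ultimately show ?thesis by simp
qed

section \<open>The resolvent\<close>

lemma cnj_sgn_mult: "cnj (sgn x) * x = of_real (cmod x)"
proof (cases "x = 0")
  case False
  have "cnj x * x = of_real (cmod x) * of_real (cmod x)"
    using complex_norm_square[of x] by (simp add: power2_eq_square mult.commute)
  then show ?thesis
    using False by (simp add: sgn_eq)
qed simp

text \<open>Here \<open>a\<close> plays the role of K - 1, so that a + 1 is the half-width of the
  contour.\<close>

locale bounded_schroedinger =
  fixes V :: "int \<Rightarrow> real" and a :: real
  assumes bounded_V: "bounded (range V)"
    and spectrum: "op_spectrum (schroedinger V) \<subseteq> complex_of_real ` {-a..a}"
    and a_nonneg: "0 \<le> a"
begin

abbreviation "H \<equiv> schroedinger V"

sublocale H: bounded_linear H
  by (rule bounded_linear_schroedinger[OF bounded_V])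

lemmas H_nth = ell2_nth_schroedinger[OF bounded_V]

text \<open>The Rayleigh quotient q of u lies in [-a, a]. Testing (H - w) u against u rotated by the
  phase of q - w yields |q - w| |u|^2, and Cauchy-Schwarz finishes.\<close>

lemma norm_shifted_ge:
  assumes "\<And>q. \<bar>q\<bar> \<le> a \<Longrightarrow> d \<le> cmod (of_real q - w)"
  shows "d * norm u \<le> norm (H u - w *\<^sub>C u)"
proof (cases "u = 0")
  case False
  define q where "q = inner u (H u) / (norm u)\<^sup>2"
  have q: "inner u (H u) = q * (norm u)\<^sup>2"
    using False by (simp add: q_def)
  have "\<bar>q\<bar> * (norm u)\<^sup>2 \<le> a * (norm u)\<^sup>2"
    using schroedinger_numerical_range[OF bounded_V spectrum, of u] by (simp add: q abs_mult)
  then have "\<bar>q\<bar> \<le> a" using False by simp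
  from assms[OF this] have d: "d \<le> cmod (of_real q - w)" .
  define c where "c = sgn (of_real q - w)"
  have c: "cnj c * (of_real q - w) = of_real (cmod (of_real q - w))"
    unfolding c_def by (rule cnj_sgn_mult)
  have "cmod (of_real q - w) * (norm u)\<^sup>2 = Re (cnj c * (of_real q - w)) * (norm u)\<^sup>2"
    by (simp add: c)
  also have "\<dots> = inner (c *\<^sub>C u) (H u - w *\<^sub>C u)"
    by (simp add: inner_diff_right schroedinger_inner_scaleC[OF bounded_V] inner_scaleC_scaleC q
        algebra_simps)
  also have "\<dots> \<le> norm (c *\<^sub>C u) * norm (H u - w *\<^sub>C u)"
    by (rule norm_cauchy_schwarz)
  also have "\<dots> \<le> norm u * norm (H u - w *\<^sub>C u)"
    by (intro mult_right_mono) (auto simp: norm_scaleC c_def norm_sgn)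
  finally have "norm u * (cmod (of_real q - w) * norm u) \<le> norm u * norm (H u - w *\<^sub>C u)"
    by (simp add: power2_eq_square mult_ac)
  then have "cmod (of_real q - w) * norm u \<le> norm (H u - w *\<^sub>C u)"
    using False by simp
  then show ?thesis
    by (rule order_trans[OF mult_right_mono[OF d norm_ge_zero]])
qed simp

text \<open>The complement of the interval, a subset of the resolvent set for which openness and
  distances are elementary.\<close>

definition off_spectrum :: "complex set" where
  "off_spectrum = - complex_of_real ` {-a..a}"

text \<open>A two-sided inverse is unique, so on \<open>off_spectrum\<close> the choice is forced.
  The convention is the inverse of H - z, which explains the minus signs in the contour
  integrals.\<close>

definition res :: "complex \<Rightarrow> int ell2 \<Rightarrow> int ell2" where
  "res z = (SOME R. bounded_linear R \<and> (\<forall>c u. R (c *\<^sub>C u) = c *\<^sub>C R u) \<and>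
     (\<forall>u. R (H u - z *\<^sub>C u) = u) \<and> (\<forall>u. H (R u) - z *\<^sub>C R u = u))"

lemma res:
  assumes "z \<in> off_spectrum"
  shows "bounded_linear (res z)" "res z (c *\<^sub>C u) = c *\<^sub>C res z u"
    "res z (H u - z *\<^sub>C u) = u" "H (res z u) - z *\<^sub>C res z u = u"
proof -
  have "z \<in> resolvent_set H"
    using assms spectrum by (auto simp: off_spectrum_def op_spectrum_def)
  then have "\<exists>R. bounded_linear R \<and> (\<forall>c u. R (c *\<^sub>C u) = c *\<^sub>C R u) \<and>
     (\<forall>u. R (H u - z *\<^sub>C u) = u) \<and> (\<forall>u. H (R u) - z *\<^sub>C R u = u)"
    by (simp add: resolvent_set_def)
  note * = someI_ex[OF this, folded res_def]
  from * show "bounded_linear (res z)" by (elim conjE)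
  from * show "res z (c *\<^sub>C u) = c *\<^sub>C res z u" by (elim conjE) (erule allE)+
  from * show "res z (H u - z *\<^sub>C u) = u" by (elim conjE) (erule spec)
  from * show "H (res z u) - z *\<^sub>C res z u = u" by (elim conjE) (erule spec)
qed

lemma norm_res_le:
  assumes "z \<in> off_spectrum" "\<And>q. \<bar>q\<bar> \<le> a \<Longrightarrow> d \<le> cmod (of_real q - z)"
  shows "d * norm (res z u) \<le> norm u"
  using norm_shifted_ge[OF assms(2), of "res z u"] res(4)[OF assms(1), of u] by simp

lemma resolvent_identity:
  assumes "z \<in> off_spectrum" "w \<in> off_spectrum"
  shows "res w x - res z x = (w - z) *\<^sub>C res w (res z x)"
proof -
  interpret R: bounded_linear "res w" by (rule res[OF assms(2)])
  let ?y = "res z x"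
  have "H ?y - w *\<^sub>C ?y = x - (w - z) *\<^sub>C ?y"
  proof (rule ell2_eqI)
    fix n
    show "ell2_nth (H ?y - w *\<^sub>C ?y) n = ell2_nth (x - (w - z) *\<^sub>C ?y) n"
      using arg_cong[OF res(4)[OF assms(1), of x], of "\<lambda>u. ell2_nth u n"]
      by (simp add: ell2_nth_simps algebra_simps)
  qed
  then have "?y = res w x - (w - z) *\<^sub>C res w ?y"
    using res(3)[OF assms(2), of ?y] by (simp add: R.diff res(2)[OF assms(2)])
  then show ?thesis by (simp add: algebra_simps)
qed

section \<open>Analytic dependence on the spectral parameter\<close>

lemma open_off_spectrum: "open off_spectrum"
proof -
  have "compact (complex_of_real ` {-a..a})"
    by (rule compact_continuous_image) (auto intro: continuous_on_of_real_id)
  then show ?thesis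
    unfolding off_spectrum_def by (rule open_Compl[OF compact_imp_closed])
qed

text \<open>Halving the radius lets one number \<open>d\<close> be both the size of the
  neighbourhood and the distance to the interval, hence a resolvent bound 1 / d uniform near
  z.\<close>

lemma off_spectrum_dist:
  assumes "z \<in> off_spectrum"
  shows "\<exists>d>0. \<forall>w. dist w z < d \<longrightarrow> w \<in> off_spectrum \<and> (\<forall>q. \<bar>q\<bar> \<le> a \<longrightarrow> d \<le> cmod (of_real q - w))"
proof -
  obtain e where e: "e > 0" "ball z e \<subseteq> off_spectrum"
    using open_off_spectrum assms openE by blast
  show ?thesis
  proof (intro exI[of _ "e / 2"] conjI allI impI)
    show "e / 2 > 0" using e by simp
    fix w assume w: "dist w z < e / 2"
    show "w \<in> off_spectrum"
      using w e by (intro subsetD[OF e(2)]) (simp add: dist_commute)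
    fix q :: real assume "\<bar>q\<bar> \<le> a"
    then have "complex_of_real q \<notin> off_spectrum"
      by (auto simp: off_spectrum_def abs_le_iff)
    then have "e \<le> dist z (of_real q)"
      using e(2) by (meson linorder_not_le mem_ball subsetD)
    also have "\<dots> \<le> dist w z + dist (of_real q) w"
      using dist_triangle[of z "of_real q" w] by (simp add: dist_commute)
    finally show "e / 2 \<le> cmod (of_real q - w)"
      using w by (simp add: dist_norm)
  qed
qed

text \<open>Using the resolvent identity twice, the difference quotient minus the claimed derivative
  is (w - z) times a coordinate of a triple product of resolvents, which is bounded near z.\<close>

lemma res_nth_has_field_derivative:
  assumes z: "z \<in> off_spectrum"
  shows "((\<lambda>w. ell2_nth (res w x) n) has_field_derivative ell2_nth (res z (res z x)) n) (at z)"
proof -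
  obtain d where d: "d > 0" "\<And>w q. dist w z < d \<Longrightarrow> \<bar>q\<bar> \<le> a \<Longrightarrow> d \<le> cmod (of_real q - w)"
    "\<And>w. dist w z < d \<Longrightarrow> w \<in> off_spectrum"
    using off_spectrum_dist[OF z] by metis
  let ?f = "\<lambda>w. ell2_nth (res w x) n" and ?y = "res z x" and ?D = "ell2_nth (res z (res z x)) n"
  define B where "B = norm (res z ?y) / d"
  have "((\<lambda>w. (?f w - ?f z) / (w - z) - ?D) \<longlongrightarrow> 0) (at z)"
  proof (rule Lim_null_comparison)
    show "((\<lambda>w. cmod (w - z) * B) \<longlongrightarrow> 0) (at z)"
      by (rule tendsto_mult_left_zero, rule tendsto_norm_zero, rule LIM_zero, rule tendsto_ident_at)
    show "\<forall>\<^sub>F w in at z. norm ((?f w - ?f z) / (w - z) - ?D) \<le> cmod (w - z) * B"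
      unfolding eventually_at
    proof (intro exI[of _ d] conjI ballI impI d(1))
      fix w assume w: "w \<noteq> z \<and> dist w z < d"
      have wS: "w \<in> off_spectrum" using d(3) w by blast
      have 1: "?f w - ?f z = (w - z) * ell2_nth (res w ?y) n"
        using arg_cong[OF resolvent_identity[OF z wS, of x], of "\<lambda>u. ell2_nth u n"]
        by (simp add: ell2_nth_simps)
      have 2: "ell2_nth (res w ?y) n - ?D = (w - z) * ell2_nth (res w (res z ?y)) n"
        using arg_cong[OF resolvent_identity[OF z wS, of ?y], of "\<lambda>u. ell2_nth u n"]
        by (simp add: ell2_nth_simps)
      have "(?f w - ?f z) / (w - z) - ?D = (w - z) * ell2_nth (res w (res z ?y)) n"
        unfolding 1 2[symmetric] using w by simp
      then have "norm ((?f w - ?f z) / (w - z) - ?D)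
          = cmod (w - z) * cmod (ell2_nth (res w (res z ?y)) n)"
        by (simp only: norm_mult)
      also have "\<dots> \<le> cmod (w - z) * B"
      proof (intro mult_left_mono)
        have "d * norm (res w (res z ?y)) \<le> norm (res z ?y)"
          by (rule norm_res_le[OF wS d(2)]) (use w in auto)
        then have "norm (res w (res z ?y)) \<le> B"
          using d(1) by (simp add: B_def field_simps)
        then show "cmod (ell2_nth (res w (res z ?y)) n) \<le> B"
          by (rule order_trans[OF cmod_ell2_nth_le_norm])
      qed simp
      finally show "norm ((?f w - ?f z) / (w - z) - ?D) \<le> cmod (w - z) * B" .
    qed
  qed
  then show ?thesis
    unfolding has_field_derivative_iff by (rule LIM_zero_cancel)
qed

definition green :: "complex \<Rightarrow> int \<Rightarrow> complex" where
  "green z n = ell2_nth (res z (delta 0)) n"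

lemma holomorphic_green: "(\<lambda>z. green z n) holomorphic_on off_spectrum"
  unfolding green_def holomorphic_on_open[OF open_off_spectrum]
  by (intro ballI exI) (erule res_nth_has_field_derivative)

lemma green_equation:
  assumes "z \<in> off_spectrum"
  shows "green z (n + 1) + green z (n - 1) + of_real (V n) * green z n
    = z * green z n + (if n = 0 then 1 else 0)"
  using arg_cong[OF res(4)[OF assms, of "delta 0"], of "\<lambda>u. ell2_nth u n"]
  by (simp add: ell2_nth_simps H_nth green_def algebra_simps)

text \<open>The Combes--Thomas estimate: conjugation by an exponential weight of rate \<open>5/4\<close> perturbs \<open>H\<close>
  by an operator of norm at most \<open>1/2\<close>.\<close>

lemma green_decay:
  assumes z: "z \<in> off_spectrum" and dist: "\<And>q. \<bar>q\<bar> \<le> a \<Longrightarrow> 1 \<le> cmod (of_real q - z)"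
    and F: "finite F" "\<And>n. n \<in> F \<Longrightarrow> int N \<le> \<bar>n\<bar>"
  shows "(\<Sum>n\<in>F. (cmod (green z n))\<^sup>2) \<le> 4 * (16 / 25) ^ N"
proof -
  \<comment> \<open>Capping the exponent at N keeps the weight bounded, so the weighted Green
    function is square summable without prior knowledge of decay. Since w 0 = 1, the source term is
    unchanged.\<close>
  define w :: "int \<Rightarrow> real" where "w n = (5 / 4) ^ min (nat \<bar>n\<bar>) N" for n
  have w_pos: "w n > 0" for n by (simp add: w_def)
  \<comment> \<open>Worst case: w falls by the factor 4/5 from n to m, where the jump is exactly w m
    / 4.\<close>
  have w_step: "\<bar>w m - w n\<bar> \<le> 1 / 4 * w m" if "m = n + 1 \<or> m = n - 1" for m n
  proof -
    have "\<bar>(5 / 4) ^ i - (5 / 4) ^ j\<bar> \<le> 1 / 4 * (5 / 4 :: real) ^ i"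
      if "i = j \<or> i = Suc j \<or> j = Suc i" for i j :: nat
      using that by auto
    moreover have "min (nat \<bar>m\<bar>) N = min (nat \<bar>n\<bar>) N \<or> min (nat \<bar>m\<bar>) N = Suc (min (nat \<bar>n\<bar>) N)
        \<or> min (nat \<bar>n\<bar>) N = Suc (min (nat \<bar>m\<bar>) N)"
      using that by linarith
    ultimately show ?thesis unfolding w_def by blast
  qed
  have "bounded (range w)"
  proof (rule boundedI)
    show "norm x \<le> (5 / 4) ^ N" if "x \<in> range w" for x
      using that by (auto simp: w_def intro!: power_increasing)
  qed
  define v where "v = Abs_ell2 (\<lambda>n. complex_of_real (w n) * green z n)"
  have v: "ell2_nth v n = of_real (w n) * green z n" for n
    unfolding v_def green_def
    using square_summable_bounded_mult[OF \<open>bounded (range w)\<close>] by (simp add: Abs_ell2_inverse)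
  \<comment> \<open>The commutator of H with the weight, applied to the Green function; it involves
    only differences of neighbouring weights.\<close>
  define e where "e = H v - z *\<^sub>C v - delta 0"
  have "cmod (ell2_nth e n) \<le> 1 / 4 * (cmod (ell2_nth v (n + 1)) + cmod (ell2_nth v (n - 1)))" for n
  proof -
    have d: "complex_of_real (w n) * (if n = 0 then 1 else 0) = (if n = 0 then 1 else 0)"
      by (simp add: w_def)
    have "ell2_nth e n = of_real (w (n + 1) - w n) * green z (n + 1)
        + of_real (w (n - 1) - w n) * green z (n - 1)"
      using arg_cong[OF green_equation[OF z, of n], of "\<lambda>x. of_real (w n) * x"] d
      by (simp add: e_def ell2_nth_simps H_nth v algebra_simps)
    also have "cmod \<dots> \<le> \<bar>w (n + 1) - w n\<bar> * cmod (green z (n + 1))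
        + \<bar>w (n - 1) - w n\<bar> * cmod (green z (n - 1))"
      by (rule order_trans[OF norm_triangle_ineq]) (simp only: norm_mult norm_of_real order_refl)
    also have "\<dots> \<le> (1 / 4 * w (n + 1)) * cmod (green z (n + 1))
        + (1 / 4 * w (n - 1)) * cmod (green z (n - 1))"
      by (intro add_mono mult_right_mono w_step) auto
    finally show ?thesis
      using w_pos by (simp add: v norm_mult abs_of_pos algebra_simps)
  qed
  then have "norm e \<le> 2 * (1 / 4) * norm v"
    by (rule norm_ell2_le_neighbours) simp
  moreover have "1 * norm v \<le> norm (H v - z *\<^sub>C v)"
    by (rule norm_shifted_ge) (rule dist)
  moreover have "norm (H v - z *\<^sub>C v) \<le> norm e + norm (delta 0 :: int ell2)"
    using norm_triangle_ineq[of e "delta 0"] by (simp add: e_def)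
  \<comment> \<open>|v| <= |e| + 1 <= |v| / 2 + 1, and the first term is absorbed.\<close>
  ultimately have "norm v \<le> 2"
    by (simp add: norm_delta)
  have "(\<Sum>n\<in>F. (25 / 16) ^ N * (cmod (green z n))\<^sup>2) = (\<Sum>n\<in>F. (cmod (ell2_nth v n))\<^sup>2)"
  proof (rule sum.cong)
    fix n assume "n \<in> F"
    then have "min (nat \<bar>n\<bar>) N = N" using F(2)[of n] by linarith
    moreover have "((5 / 4) ^ N)\<^sup>2 = (25 / 16 :: real) ^ N"
      unfolding power2_eq_square power_mult_distrib[symmetric] by simp
    ultimately show "(25 / 16) ^ N * (cmod (green z n))\<^sup>2 = (cmod (ell2_nth v n))\<^sup>2"
      by (simp add: v norm_mult w_def power_mult_distrib norm_power)
  qed simp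
  also have "\<dots> \<le> (norm v)\<^sup>2"
    by (rule sum_cmod_square_le_norm[OF F(1)])
  also have "\<dots> \<le> 2\<^sup>2"
    by (rule power_mono) (use \<open>norm v \<le> 2\<close> in auto)
  finally have "(25 / 16) ^ N * (\<Sum>n\<in>F. (cmod (green z n))\<^sup>2) \<le> 4"
    by (simp add: sum_distrib_left)
  then have "(16 / 25) ^ N * ((25 / 16) ^ N * (\<Sum>n\<in>F. (cmod (green z n))\<^sup>2)) \<le> (16 / 25) ^ N * 4"
    by (rule mult_left_mono) simp
  moreover have "(16 / 25 :: real) ^ N * (25 / 16) ^ N = 1"
    unfolding power_mult_distrib[symmetric] by simp
  ultimately show ?thesis
    unfolding mult.assoc[symmetric] by simp
qed

section \<open>Cutting a bond\<close>

text \<open>If \<open>f\<close> is the difference of the Green functions with sources \<open>0\<close> and \<open>p\<close>, normalised to vanish at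
  \<open>p\<close> and truncated to the side of \<open>p\<close> containing \<open>0\<close>, then \<open>(H - z) f\<close> differs from \<open>delta 0\<close> only at \<open>p\<close>. The
  sign \<open>s\<close> selects the side.\<close>

lemma green_cut:
  assumes z: "Im z = \<epsilon>" "\<epsilon> > 0" and s: "s = 1 \<or> s = (-1 :: int)" and p: "s * p > 0"
  obtains f where "norm f \<le> 1 / \<epsilon>" "H f - z *\<^sub>C f = delta 0 + ell2_nth f (p - s) *\<^sub>C delta p"
    "ell2_nth f p = 0"
    "\<And>F. finite F \<Longrightarrow> (\<And>n. n \<in> F \<Longrightarrow> s * p \<le> s * n) \<Longrightarrow>
      (\<Sum>n\<in>F. (cmod (green z n))\<^sup>2) \<le> (cmod (ell2_nth f (p - s)))\<^sup>2 / \<epsilon>\<^sup>2"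
proof -
  have zS: "z \<in> off_spectrum" using z by (auto simp: off_spectrum_def)
  have dist: "\<epsilon> \<le> cmod (of_real q - z)" for q
    using abs_Im_le_cmod[of "of_real q - z"] z by simp
  define u where "u = res z (delta 0)"
  define v where "v = res z (delta p)"
  have u: "H u - z *\<^sub>C u = delta 0" and v: "H v - z *\<^sub>C v = delta p"
    unfolding u_def v_def by (rule res(4)[OF zS])+
  \<comment> \<open>The real form <x, H x> drops out when tested against \<i> x, leaving only Im
    z.\<close>
  have test: "\<epsilon> * (norm x)\<^sup>2 = - inner (\<i> *\<^sub>C x) (H x - z *\<^sub>C x)" for x
    by (simp add: inner_diff_right schroedinger_inner_scaleC[OF bounded_V] inner_scaleC_scaleC z)
  \<comment> \<open>This allows division by the diagonal Green function at p in \<alpha>.\<close>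
  have vp: "ell2_nth v p \<noteq> 0"
  proof
    assume 0: "ell2_nth v p = 0"
    have "\<epsilon> * (norm v)\<^sup>2 = 0"
      by (simp add: test v inner_delta_right ell2_nth_scaleC 0)
    then have "v = 0" using z by simp
    then have "delta p = 0"
      using v by (simp add: H.zero scaleC_zero_right)
    then show False using norm_delta[of p] by simp
  qed
  define \<alpha> where "\<alpha> = ell2_nth u p / ell2_nth v p"
  define g where "g n = (if s * n < s * p then ell2_nth u n - \<alpha> * ell2_nth v n else 0)" for n
  have "square_summable g"
    by (rule square_summable_mono[of "ell2_nth (u - \<alpha> *\<^sub>C v)"]) (simp, simp add: g_def ell2_nth_simps)
  define f where "f = Abs_ell2 g"
  have f: "ell2_nth f = g"
    using \<open>square_summable g\<close> by (simp add: f_def Abs_ell2_inverse)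
  have eq: "H f - z *\<^sub>C f = delta 0 + ell2_nth f (p - s) *\<^sub>C delta p"
  proof (rule ell2_eqI)
    fix n
    have at_p: "ell2_nth u p - \<alpha> * ell2_nth v p = 0" using vp by (simp add: \<alpha>_def)
    have un: "ell2_nth u (n + 1) + ell2_nth u (n - 1) + of_real (V n) * ell2_nth u n - z * ell2_nth u n
        = (if n = 0 then 1 else 0)"
      using arg_cong[OF u, of "\<lambda>u. ell2_nth u n"] by (simp add: ell2_nth_simps H_nth)
    have vn: "ell2_nth v (n + 1) + ell2_nth v (n - 1) + of_real (V n) * ell2_nth v n - z * ell2_nth v n
        = (if n = p then 1 else 0)"
      using arg_cong[OF v, of "\<lambda>u. ell2_nth u n"] by (simp add: ell2_nth_simps H_nth)
    \<comment> \<open>At p the formula and the truncated value agree, both being zero by the choice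
      of \<alpha>. Hence the equation is undisturbed at every site before p.\<close>
    have g1: "g m = ell2_nth u m - \<alpha> * ell2_nth v m" if "s * m \<le> s * p" for m
      using that at_p s by (cases "m = p") (auto simp: g_def)
    have g0: "g m = 0" if "s * p \<le> s * m" for m using that by (simp add: g_def)
    consider "s * n < s * p" | "n = p" | "s * p < s * n"
      using s by fastforce
    then have "g (n + 1) + g (n - 1) + of_real (V n) * g n - z * g n
        = (if n = 0 then 1 else 0) + g (p - s) * (if n = p then 1 else 0)"
    proof cases
      case 1
      then have "s * (n + 1) \<le> s * p" "s * (n - 1) \<le> s * p" "s * n \<le> s * p" "n \<noteq> p"
        using s by auto
      then have "g (n + 1) + g (n - 1) + of_real (V n) * g n - z * g n
        = (if n = 0 then 1 else 0) - \<alpha> * (if n = p then 1 else 0)"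
        unfolding un[symmetric] vn[symmetric] by (simp add: g1 algebra_simps)
      then show ?thesis using \<open>n \<noteq> p\<close> by simp
    next
      case 2
      moreover have "p \<noteq> 0" "g p = 0" "g (p + s) = 0" using p g0[of p] g0[of "p + s"] s by auto
      ultimately show ?thesis using s by auto
    next
      case 3
      then have "s * p \<le> s * (n + 1)" "s * p \<le> s * (n - 1)" "s * p \<le> s * n" "n \<noteq> p" "n \<noteq> 0"
        using s p by auto
      then show ?thesis by (simp add: g0)
    qed
    then show "ell2_nth (H f - z *\<^sub>C f) n = ell2_nth (delta 0 + ell2_nth f (p - s) *\<^sub>C delta p) n"
      by (simp add: ell2_nth_simps H_nth f)
  qed
  have fp: "ell2_nth f p = 0" by (simp add: f g_def)
  show ?thesis
  proof
    show "H f - z *\<^sub>C f = delta 0 + ell2_nth f (p - s) *\<^sub>C delta p" "ell2_nth f p = 0"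
      by (fact eq fp)+
    \<comment> \<open>Because f(p) = 0, the source at p is orthogonal to \<i> f whatever its
      strength. So f obeys the same norm bound as the Green function, although
      \<open>ell2_nth f (p - s)\<close> is not yet controlled.\<close>
    have "inner (\<i> *\<^sub>C f) (b *\<^sub>C delta p) = 0" for b
      using inner_scaleC_left[of "cnj b" "\<i> *\<^sub>C f" "delta p"]
      by (simp add: inner_delta_right ell2_nth_simps fp)
    then have "\<epsilon> * (norm f)\<^sup>2 = - Re (ell2_nth (\<i> *\<^sub>C f) 0)"
      by (simp add: test eq inner_add_right inner_delta_right)
    also have "\<dots> \<le> cmod (ell2_nth f 0)"
      using abs_Im_le_cmod[of "ell2_nth f 0"] by (simp add: ell2_nth_scaleC)
    also have "\<dots> \<le> norm f" by (rule cmod_ell2_nth_le_norm)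
    finally have "norm f * (\<epsilon> * norm f) \<le> norm f * 1"
      by (simp add: power2_eq_square mult_ac)
    then show "norm f \<le> 1 / \<epsilon>"
      using z by (cases "f = 0") (simp_all add: field_simps)
    fix F assume F: "finite F" "\<And>n. n \<in> F \<Longrightarrow> s * p \<le> s * n"
    let ?b = "ell2_nth f (p - s)"
    interpret R: bounded_linear "res z" by (rule res[OF zS])
    \<comment> \<open>H - z maps u - f to a multiple of \<open>delta p\<close>, so u - f is that
      multiple of v; from p outwards f vanishes and only this multiple remains.\<close>
    have "u - f = res z (delta 0 - (H f - z *\<^sub>C f))"
      by (subst R.diff) (simp only: res(3)[OF zS] u_def)
    also have "\<dots> = - (?b *\<^sub>C v)"
      by (simp add: eq R.neg res(2)[OF zS] v_def)
    finally have uf: "u - f = - (?b *\<^sub>C v)" .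
    have "green z n = - (?b * ell2_nth v n)" if "n \<in> F" for n
      using arg_cong[OF uf, of "\<lambda>u. ell2_nth u n"] F(2)[OF that]
      by (simp add: ell2_nth_simps f g_def green_def u_def)
    then have "(\<Sum>n\<in>F. (cmod (green z n))\<^sup>2) = (cmod ?b)\<^sup>2 * (\<Sum>n\<in>F. (cmod (ell2_nth v n))\<^sup>2)"
      unfolding sum_distrib_left by (intro sum.cong) (simp_all add: norm_mult power_mult_distrib)
    also have "\<dots> \<le> (cmod ?b)\<^sup>2 * (norm v)\<^sup>2"
      by (intro mult_left_mono sum_cmod_square_le_norm F) simp
    also have "\<epsilon> * norm v \<le> norm (delta p)"
      unfolding v_def by (rule norm_res_le[OF zS dist])
    then have "norm v \<le> 1 / \<epsilon>" using z by (simp add: norm_delta field_simps)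
    then have "(cmod ?b)\<^sup>2 * (norm v)\<^sup>2 \<le> (cmod ?b)\<^sup>2 * (1 / \<epsilon>)\<^sup>2"
      by (intro mult_left_mono power_mono) auto
    finally show "(\<Sum>n\<in>F. (cmod (green z n))\<^sup>2) \<le> (cmod ?b)\<^sup>2 / \<epsilon>\<^sup>2"
      by (simp add: power_divide)
  qed
qed

end

section \<open>Transfer matrices\<close>

lemma step_matrix_nth:
  "step_matrix V m z $ 1 $ 1 = z - of_real (V m)" "step_matrix V m z $ 1 $ 2 = -1"
  "step_matrix V m z $ 2 $ 1 = 1" "step_matrix V m z $ 2 $ 2 = 0"
  by (simp_all add: step_matrix_def)

text \<open>One recursion valid on both sides of 0. Step matrices have determinant 1, so for n <= 0
  the new factor cancels the outermost inverse of the backward product.\<close>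

lemma transfer_matrix_step:
  "transfer_matrix V n z = step_matrix V n z ** transfer_matrix V (n - 1) z"
proof (cases "n \<ge> 1")
  case True
  then have "nat n = Suc (nat (n - 1))" "int (nat (n - 1)) + 1 = n"
    by linarith+
  then show ?thesis
    using True by (simp add: transfer_matrix_def)
next
  case False
  have "det (step_matrix V n z) = 1"
    by (simp add: det_2 step_matrix_nth)
  then have inv: "step_matrix V n z ** matrix_inv (step_matrix V n z) = mat 1"
    using someI_ex[of "\<lambda>B. step_matrix V n z ** B = mat 1 \<and> B ** step_matrix V n z = mat 1"]
    by (simp add: matrix_inv_def invertible_det_nz flip: invertible_def)
  have "nat (- (n - 1)) = Suc (nat (- n))" "- int (nat (- n)) = n"
    using False by linarith+
  then have "transfer_matrix V (n - 1) z =
      matrix_inv (step_matrix V n z) ** transfer_backward V (nat (- n)) z"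
    using False by (simp add: transfer_matrix_def)
  moreover have "transfer_matrix V n z = transfer_backward V (nat (- n)) z"
    using False by (cases "n = 0") (simp_all add: transfer_matrix_def)
  ultimately show ?thesis
    by (simp add: matrix_mul_assoc inv)
qed

text \<open>\<Phi>(n) sends (u(1), u(0)) to (u(n+1), u(n)) for solutions u, so its second row holds
  the values at n of two solutions: j = 1 has u(0) = 0, u(1) = 1, and j = 2 has u(0) = 1, u(1) =
  0.\<close>

definition transfer_solution :: "(int \<Rightarrow> real) \<Rightarrow> complex \<Rightarrow> 2 \<Rightarrow> int \<Rightarrow> complex" where
  "transfer_solution V z j n = transfer_matrix V n z $ 2 $ j"

lemma transfer_matrix_nth:
  "transfer_matrix V n z $ 1 $ j = transfer_solution V z j (n + 1)"
  "transfer_matrix V n z $ 2 $ j = transfer_solution V z j n"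
  by (simp_all add: transfer_solution_def transfer_matrix_step[of V "n + 1"] matrix_matrix_mult_def
      sum_2 step_matrix_nth)

lemma transfer_solution_rec:
  "transfer_solution V z j (n + 1) + transfer_solution V z j (n - 1)
    + of_real (V n) * transfer_solution V z j n = z * transfer_solution V z j n"
proof -
  have "transfer_matrix V n z $ 1 $ j = (z - of_real (V n)) * transfer_matrix V (n - 1) z $ 1 $ j
      - transfer_matrix V (n - 1) z $ 2 $ j"
    by (subst transfer_matrix_step) (simp add: matrix_matrix_mult_def sum_2 step_matrix_nth)
  then show ?thesis
    by (simp add: transfer_matrix_nth algebra_simps)
qed

lemma transfer_solution_0:
  "transfer_solution V z 1 0 = 0" "transfer_solution V z 2 0 = 1"
  "transfer_solution V z 1 1 = 1" "transfer_solution V z 2 1 = 0"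
proof -
  have "transfer_matrix V 0 z = mat 1"
    by (simp add: transfer_matrix_def)
  then show "transfer_solution V z 1 0 = 0" "transfer_solution V z 2 0 = 1"
    "transfer_solution V z 1 1 = 1" "transfer_solution V z 2 1 = 0"
    using transfer_matrix_nth(1)[of V 0 z 1] transfer_matrix_nth(1)[of V 0 z 2]
    by (simp_all add: transfer_solution_def mat_def)
qed

lemma continuous_on_transfer_solution: "continuous_on S (\<lambda>z. transfer_solution V z j n)"
proof -
  \<comment> \<open>The recursion has second order, so the induction carries two neighbouring
    sites.\<close>
  have "continuous_on S (\<lambda>z. transfer_solution V z j n) \<and>
    continuous_on S (\<lambda>z. transfer_solution V z j (n + 1))"
  proof (induction n rule: int_induct[where k = 0])
    case base
    show ?case
      using exhaust_2[of j] by (auto simp: transfer_solution_0)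
  next
    case (step1 i)
    have "transfer_solution V z j (i + 1 + 1) =
        (z - of_real (V (i + 1))) * transfer_solution V z j (i + 1) - transfer_solution V z j i" for z
      using transfer_solution_rec[of V z j "i + 1"] by (simp add: algebra_simps)
    with step1 show ?case
      by (auto intro!: continuous_intros)
  next
    case (step2 i)
    have "transfer_solution V z j (i - 1) =
        (z - of_real (V i)) * transfer_solution V z j i - transfer_solution V z j (i + 1)" for z
      using transfer_solution_rec[of V z j "i"] by (simp add: algebra_simps)
    with step2 show ?case
      by (auto intro!: continuous_intros)
  qed
  then show ?thesis ..
qed

section \<open>The operator norm of a 2x2 matrix\<close>

lemma norm_square_complex_2_2:
  fixes A :: "complex^2^2"
  shows "(norm A)\<^sup>2 = (cmod (A $ 1 $ 1))\<^sup>2 + (cmod (A $ 1 $ 2))\<^sup>2 + (cmod (A $ 2 $ 1))\<^sup>2 + (cmod (A $ 2 $ 2))\<^sup>2"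
  by (simp add: norm_vec_def L2_set_def sum_2)

text \<open>\<open>norm\<close> on matrices is the Frobenius norm, so this is Cauchy-Schwarz row by
  row.\<close>

lemma norm_matrix_vector_le: "norm (A *v x) \<le> norm A * norm x" for A :: "complex^2^2"
proof -
  have *: "(cmod (a * y1 + b * y2))\<^sup>2 \<le> ((cmod a)\<^sup>2 + (cmod b)\<^sup>2) * ((cmod y1)\<^sup>2 + (cmod y2)\<^sup>2)"
    for a b y1 y2
  proof -
    have "cmod (a * y1 + b * y2) \<le> cmod a * cmod y1 + cmod b * cmod y2"
      by (rule order_trans[OF norm_triangle_ineq]) (simp add: norm_mult)
    then have "(cmod (a * y1 + b * y2))\<^sup>2 \<le> (cmod a * cmod y1 + cmod b * cmod y2)\<^sup>2"
      by (rule power_mono) simp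
    also have "\<dots> \<le> ((cmod a)\<^sup>2 + (cmod b)\<^sup>2) * ((cmod y1)\<^sup>2 + (cmod y2)\<^sup>2)"
      using zero_le_power2[of "cmod a * cmod y2 - cmod b * cmod y1"]
      by (simp add: power2_eq_square algebra_simps)
    finally show ?thesis .
  qed
  have n: "(norm y)\<^sup>2 = (cmod (y $ 1))\<^sup>2 + (cmod (y $ 2))\<^sup>2" for y :: "complex^2"
    by (simp add: norm_vec_def L2_set_def sum_2)
  have "(norm (A *v x))\<^sup>2 \<le> (norm A * norm x)\<^sup>2"
    using *[of "A $ 1 $ 1" "x $ 1" "A $ 1 $ 2" "x $ 2"] *[of "A $ 2 $ 1" "x $ 1" "A $ 2 $ 2" "x $ 2"]
    by (simp add: power_mult_distrib n norm_square_complex_2_2 matrix_vector_mult_def sum_2 distrib_right)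
  then show ?thesis
    by (rule power2_le_imp_le) simp
qed

lemma bounded_linear_matrix_vector: "bounded_linear ((*v) A)" for A :: "complex^2^2"
proof (rule bounded_linear_intro)
  show "A *v (x + y) = A *v x + A *v y" for x y
    by (rule matrix_vector_right_distrib)
  show "A *v (r *\<^sub>R x) = r *\<^sub>R (A *v x)" for r x
    by (simp add: vec_eq_iff matrix_vector_mult_def scaleR_sum_right)
  show "norm (A *v x) \<le> norm x * norm A" for x
    using norm_matrix_vector_le[of A x] by (simp add: mult.commute)
qed

lemma matrix_norm_le_norm: "matrix_norm A \<le> norm A"
  unfolding matrix_norm_def by (rule onorm_bound) (simp_all add: norm_matrix_vector_le)

lemma matrix_norm_nonneg: "0 \<le> matrix_norm A"
  unfolding matrix_norm_def by (rule onorm_pos_le[OF bounded_linear_matrix_vector])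

lemma matrix_norm_triangle: "matrix_norm (A + B) \<le> matrix_norm A + matrix_norm B"
  using onorm_triangle[OF bounded_linear_matrix_vector[of A] bounded_linear_matrix_vector[of B]]
  by (simp add: matrix_norm_def matrix_vector_mult_add_rdistrib[abs_def])

lemma matrix_norm_mat_1: "matrix_norm (mat 1) = 1"
proof -
  have "(*v) (mat 1 :: complex^2^2) = (\<lambda>x. x)"
    by (simp add: fun_eq_iff)
  then show ?thesis
    by (simp add: matrix_norm_def onorm_id)
qed

lemma continuous_on_matrix_norm: "continuous_on S matrix_norm"
proof -
  have "\<bar>matrix_norm A - matrix_norm B\<bar> \<le> norm (A - B)" for A B
    using matrix_norm_triangle[of "A - B" B] matrix_norm_triangle[of "B - A" A]
      matrix_norm_le_norm[of "A - B"] matrix_norm_le_norm[of "B - A"] norm_minus_commute[of A B]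
    by simp
  then have "1-lipschitz_on S matrix_norm"
    by (intro lipschitz_onI) (auto simp: dist_norm)
  then show ?thesis
    by (rule lipschitz_on_continuous_on)
qed

lemma continuous_on_Max:
  fixes f :: "'i \<Rightarrow> 'a::topological_space \<Rightarrow> real"
  assumes "finite I" "I \<noteq> {}" "\<And>i. i \<in> I \<Longrightarrow> continuous_on S (f i)"
  shows "continuous_on S (\<lambda>x. MAX i\<in>I. f i x)"
  using assms
proof (induction rule: finite_ne_induct)
  case (insert i I)
  then show ?case
    by (simp add: continuous_on_max)
qed simp

lemma continuous_on_matrix_norm_transfer: "continuous_on S (\<lambda>z. matrix_norm (transfer_matrix V n z))"
proof (rule continuous_on_compose2[OF continuous_on_matrix_norm[of UNIV]])
  have "continuous_on S (\<lambda>z. transfer_matrix V n z $ i $ j)" for i j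
    using exhaust_2[of i] by (auto simp: transfer_matrix_nth continuous_on_transfer_solution)
  then have "continuous_on S (\<lambda>z. \<chi> i j. transfer_matrix V n z $ i $ j)"
    by (intro continuous_on_vec_lambda)
  then show "continuous_on S (transfer_matrix V n)"
    by (simp add: vec_lambda_eta)
qed simp

text \<open>Passing to the Frobenius norm splits the estimate into the row at n + 1 and the row at
  n, each of which can be bounded by a cut at its own site.\<close>

lemma matrix_norm_transfer_square_le:
  "(matrix_norm (transfer_matrix V n z))\<^sup>2 \<le>
    ((cmod (transfer_solution V z 1 (n + 1)))\<^sup>2 + (cmod (transfer_solution V z 2 (n + 1)))\<^sup>2) +
    ((cmod (transfer_solution V z 1 n))\<^sup>2 + (cmod (transfer_solution V z 2 n))\<^sup>2)"
proof -
  have "(matrix_norm (transfer_matrix V n z))\<^sup>2 \<le> (norm (transfer_matrix V n z))\<^sup>2"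
    by (intro power_mono matrix_norm_le_norm matrix_norm_nonneg)
  then show ?thesis
    by (simp add: norm_square_complex_2_2 transfer_matrix_nth)
qed

section \<open>Green function tails from the Wronskian\<close>

context bounded_schroedinger
begin

text \<open>The equation for \<open>f\<close> is demanded only on the sites l, ..., m - 1, so the
  range can stop short of the sources at 0 and p.\<close>

lemma wronskian_const:
  assumes f: "\<And>n. l \<le> n \<Longrightarrow> n < m \<Longrightarrow> f (n + 1) + f (n - 1) + of_real (V n) * f n = z * f n"
    and g: "\<And>n. g (n + 1) + g (n - 1) + of_real (V n) * g n = z * g n" and "l \<le> m"
  shows "f m * g (m - 1) - f (m - 1) * g m = f l * g (l - 1) - f (l - 1) * (g l :: complex)"
  using \<open>l \<le> m\<close> f
proof (induction m rule: int_ge_induct)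
  case (step m)
  have f: "f (m + 1) = z * f m - of_real (V m) * f m - f (m - 1)"
    using step(3)[of m] step(1) by (simp add: algebra_simps)
  have g: "g (m + 1) = z * g m - of_real (V m) * g m - g (m - 1)"
    using g[of m] by (simp add: algebra_simps)
  have "f (m + 1) * g (m + 1 - 1) - f (m + 1 - 1) * g (m + 1)
      = f m * g (m - 1) - f (m - 1) * g m"
    unfolding add_diff_cancel_right' f g by (simp add: algebra_simps)
  also have "\<dots> = f l * g (l - 1) - f (l - 1) * g l"
    using step by simp
  finally show ?case .
qed simp

abbreviation row_norm2 :: "complex \<Rightarrow> int \<Rightarrow> real" where
  "row_norm2 z p \<equiv> (cmod (transfer_solution V z 1 p))\<^sup>2 + (cmod (transfer_solution V z 2 p))\<^sup>2"

text \<open>Between 0 and p the cut function f solves the homogeneous equation. Its Wronskian with a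
  standard solution is, up to sign, f(p - s) times that solution at p, since f(p) = 0; near 0 it is
  a combination of f(0) and f(1), which are at most 1 / \<epsilon>.\<close>

lemma green_tail_row:
  assumes z: "Im z = \<epsilon>" "\<epsilon> > 0" "\<epsilon> \<le> 1" and s: "s = 1 \<or> s = (-1 :: int)" and p: "s * p > 0"
    and F: "finite F" "\<And>n. n \<in> F \<Longrightarrow> s * p \<le> s * n"
  shows "(\<Sum>n\<in>F. (cmod (green z n))\<^sup>2) * row_norm2 z p \<le> 4 / \<epsilon> ^ 4"
proof -
  obtain f where f: "norm f \<le> 1 / \<epsilon>" "H f - z *\<^sub>C f = delta 0 + ell2_nth f (p - s) *\<^sub>C delta p"
    "ell2_nth f p = 0"
    "\<And>F. finite F \<Longrightarrow> (\<And>n. n \<in> F \<Longrightarrow> s * p \<le> s * n) \<Longrightarrow>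
      (\<Sum>n\<in>F. (cmod (green z n))\<^sup>2) \<le> (cmod (ell2_nth f (p - s)))\<^sup>2 / \<epsilon>\<^sup>2"
    using green_cut[OF z(1,2) s p] by metis
  let ?f = "ell2_nth f" and ?b = "ell2_nth f (p - s)"
  have eqn: "?f (n + 1) + ?f (n - 1) + of_real (V n) * ?f n = z * ?f n + (if n = 0 then 1 else 0)"
    if "n \<noteq> p" for n
    using arg_cong[OF f(2), of "\<lambda>u. ell2_nth u n"] that
    by (simp add: ell2_nth_simps H_nth algebra_simps)
  have "(\<Sum>n\<in>{0, 1}. (cmod (?f n))\<^sup>2) \<le> (norm f)\<^sup>2"
    by (rule sum_cmod_square_le_norm) simp
  also have "\<dots> \<le> (1 / \<epsilon>)\<^sup>2"
    using f(1) by (rule power_mono) simp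
  finally have f01: "(cmod (?f 0))\<^sup>2 + (cmod (?f 1))\<^sup>2 \<le> 1 / \<epsilon>\<^sup>2"
    by (simp add: power_divide)
  \<comment> \<open>Absorbs the unit source at 0, which enters the Wronskian when the cut is on the
    left.\<close>
  have "1 \<le> 1 / \<epsilon>\<^sup>2"
    using z by (simp add: power_le_one)
  have row: "(cmod ?b)\<^sup>2 * row_norm2 z p \<le> 4 / \<epsilon>\<^sup>2"
    using s
  proof
    assume s1: "s = 1"
    have w: "?f p * g (p - 1) - ?f (p - 1) * g p = ?f 1 * g 0 - ?f 0 * g 1"
      if "\<And>n. g (n + 1) + g (n - 1) + of_real (V n) * g n = z * g n" for g
      using wronskian_const[of 1 p ?f z g] eqn that p s1 by simp
    have "?b * transfer_solution V z 1 p = ?f 0" "?b * transfer_solution V z 2 p = - ?f 1"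
      using w[of "transfer_solution V z 1", OF transfer_solution_rec]
        w[of "transfer_solution V z 2", OF transfer_solution_rec]
      by (simp_all add: transfer_solution_0 f(3) s1 minus_equation_iff)
    then have "(cmod ?b)\<^sup>2 * row_norm2 z p = (cmod (?f 0))\<^sup>2 + (cmod (?f 1))\<^sup>2"
      unfolding distrib_left power_mult_distrib[symmetric] norm_mult[symmetric] by simp
    also have "\<dots> \<le> 4 / \<epsilon>\<^sup>2"
      using f01 \<open>1 \<le> 1 / \<epsilon>\<^sup>2\<close> by simp
    finally show ?thesis .
  next
    assume s1: "s = -1"
    have "p \<le> -1" using p s1 by simp
    \<comment> \<open>The Wronskian is constant only up to the bond between -1 and 0, while the
      standard solutions are normalised at 0 and 1. Translating to those sites crosses the source,
      which turns f(1) into f(1) - 1.\<close>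
    have w: "?f (p + 1) * g p - ?f p * g (p + 1) = ?f 0 * g (-1) - ?f (-1) * g 0"
      if "\<And>n. g (n + 1) + g (n - 1) + of_real (V n) * g n = z * g n" for g
      using wronskian_const[of "p + 1" 0 ?f z g] eqn that \<open>p \<le> -1\<close> by simp
    have fm: "?f (-1) = z * ?f 0 + 1 - ?f 1 - of_real (V 0) * ?f 0"
      using eqn[of 0] \<open>p \<le> -1\<close> by (simp add: algebra_simps)
    have gm: "transfer_solution V z j (-1) = z * transfer_solution V z j 0 - transfer_solution V z j 1
        - of_real (V 0) * transfer_solution V z j 0" for j
      using transfer_solution_rec[of V z j 0] by (simp add: algebra_simps)
    have "?b * transfer_solution V z 1 p = - ?f 0" "?b * transfer_solution V z 2 p = ?f 1 - 1"
      using w[of "transfer_solution V z 1", OF transfer_solution_rec]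
        w[of "transfer_solution V z 2", OF transfer_solution_rec]
      by (simp_all add: transfer_solution_0 f(3) s1 fm gm algebra_simps)
    then have "(cmod ?b)\<^sup>2 * row_norm2 z p = (cmod (?f 0))\<^sup>2 + (cmod (?f 1 + (-1)))\<^sup>2"
      unfolding distrib_left power_mult_distrib[symmetric] norm_mult[symmetric] by simp
    also have "(cmod (?f 1 + (-1)))\<^sup>2 \<le> 2 * (cmod (?f 1))\<^sup>2 + 2"
      using cmod_add_square_le[of "?f 1" "-1"] by simp
    also have "(cmod (?f 0))\<^sup>2 + (2 * (cmod (?f 1))\<^sup>2 + 2) \<le> 2 * (1 / \<epsilon>\<^sup>2) + 2 * (1 / \<epsilon>\<^sup>2)"
      using f01 \<open>1 \<le> 1 / \<epsilon>\<^sup>2\<close> zero_le_power2[of "cmod (?f 0)"] by linarith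
    finally show ?thesis by simp
  qed
  have "(\<Sum>n\<in>F. (cmod (green z n))\<^sup>2) * row_norm2 z p \<le> (cmod ?b)\<^sup>2 / \<epsilon>\<^sup>2 * row_norm2 z p"
    by (intro mult_right_mono f(4) F) auto
  also have "\<dots> = ((cmod ?b)\<^sup>2 * row_norm2 z p) / \<epsilon>\<^sup>2" by simp
  also have "\<dots> \<le> (4 / \<epsilon>\<^sup>2) / \<epsilon>\<^sup>2"
    by (intro divide_right_mono row) simp
  finally show ?thesis
    by (simp add: power_add[symmetric] field_simps flip: power2_eq_square)
qed

lemma green_tail_transfer:
  assumes z: "Im z = \<epsilon>" "\<epsilon> > 0" "\<epsilon> \<le> 1" and s: "s = 1 \<or> s = (-1 :: int)"
    and F: "finite F" "\<And>n. n \<in> F \<Longrightarrow> N \<le> s * n"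
    and I: "I = (if s = 1 then {0..N - 1} else {-N + 1..0})" and "N \<ge> 1"
  shows "(\<Sum>n\<in>F. (cmod (green z n))\<^sup>2) \<le>
    8 / \<epsilon> ^ 4 * inverse (MAX n\<in>I. (matrix_norm (transfer_matrix V n z))\<^sup>2)"
proof -
  define S where "S = (\<Sum>n\<in>F. (cmod (green z n))\<^sup>2)"
  have S0: "S \<ge> 0" by (simp add: S_def sum_nonneg)
  \<comment> \<open>The rows at 0 and 1 are unit vectors. When such a site is not strictly on the
    outer side of 0, no cut is possible and the plain resolvent bound 1 / \<epsilon>^2 takes
    over.\<close>
  have row: "S * row_norm2 z p \<le> 4 / \<epsilon> ^ 4" if "s * p \<le> N" "s * p > 0 \<or> p = 0 \<or> p = 1" for p
  proof (cases "s * p > 0")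
    case True
    then show ?thesis
      unfolding S_def using F that s
      by (intro green_tail_row[OF z s]) force+
  next
    case False
    have zS: "z \<in> off_spectrum" using z by (auto simp: off_spectrum_def)
    have "S \<le> (norm (res z (delta 0)))\<^sup>2"
      unfolding S_def green_def by (rule sum_cmod_square_le_norm[OF F(1)])
    moreover have "\<epsilon> * norm (res z (delta 0)) \<le> norm (delta 0 :: int ell2)"
    proof (rule norm_res_le[OF zS])
      show "\<epsilon> \<le> cmod (of_real q - z)" for q
        using abs_Im_le_cmod[of "of_real q - z"] z by simp
    qed
    then have "norm (res z (delta 0)) \<le> 1 / \<epsilon>"
      using z by (simp add: norm_delta field_simps)
    then have "(norm (res z (delta 0)))\<^sup>2 \<le> (1 / \<epsilon>)\<^sup>2"
      by (rule power_mono) simp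
    ultimately have "S \<le> 1 / \<epsilon>\<^sup>2" by (simp add: power_divide)
    also have "\<dots> \<le> 4 / \<epsilon> ^ 4"
    proof (rule frac_le)
      show "\<epsilon> ^ 4 \<le> \<epsilon>\<^sup>2" using z by (intro power_decreasing) auto
    qed (use z in auto)
    finally have "S \<le> 4 / \<epsilon> ^ 4" .
    moreover have "row_norm2 z p = 1"
      using that False by (auto simp: transfer_solution_0)
    ultimately show ?thesis by simp
  qed
  have each: "S * (matrix_norm (transfer_matrix V n z))\<^sup>2 \<le> 8 / \<epsilon> ^ 4" if "n \<in> I" for n
  proof -
    have "S * (matrix_norm (transfer_matrix V n z))\<^sup>2 \<le> S * (row_norm2 z (n + 1) + row_norm2 z n)"
      by (intro mult_left_mono matrix_norm_transfer_square_le S0)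
    also have "\<dots> = S * row_norm2 z (n + 1) + S * row_norm2 z n"
      by (simp only: distrib_left)
    also have "\<dots> \<le> 4 / \<epsilon> ^ 4 + 4 / \<epsilon> ^ 4"
      using that s I \<open>N \<ge> 1\<close> by (intro add_mono row) (auto split: if_splits)
    finally show ?thesis by simp
  qed
  have I0: "finite I" "0 \<in> I" using I \<open>N \<ge> 1\<close> by auto
  let ?M = "MAX n\<in>I. (matrix_norm (transfer_matrix V n z))\<^sup>2"
  have "?M \<in> (\<lambda>n. (matrix_norm (transfer_matrix V n z))\<^sup>2) ` I"
    using I0 by (intro Max_in) auto
  then have SM: "S * ?M \<le> 8 / \<epsilon> ^ 4" using each by auto
  \<comment> \<open>\<Phi>(0) = Id makes the maximum at least 1, so dividing by it is
    legitimate.\<close>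
  have "(matrix_norm (transfer_matrix V 0 z))\<^sup>2 \<le> ?M"
    using I0 by (intro Max_ge) auto
  then have "1 \<le> ?M" by (simp add: transfer_matrix_def matrix_norm_mat_1)
  then have "?M > 0" by simp
  with SM have "S \<le> 8 / \<epsilon> ^ 4 / ?M"
    by (simp only: pos_le_divide_eq)
  then show ?thesis
    unfolding S_def[symmetric] by (simp only: divide_inverse)
qed

end

section \<open>Integration along rectangles\<close>

lemma path_image_rectpath_segments:
  "path_image (rectpath p q) = closed_segment p (Complex (Re q) (Im p)) \<union>
     closed_segment (Complex (Re q) (Im p)) q \<union> closed_segment q (Complex (Re p) (Im q)) \<union>
     closed_segment (Complex (Re p) (Im q)) p"
  by (simp add: rectpath_def Let_def path_image_join Un_assoc)

lemma contour_integral_rectpath: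
  assumes "continuous_on (path_image (rectpath p q)) f"
  shows "contour_integral (rectpath p q) f =
    contour_integral (linepath p (Complex (Re q) (Im p))) f +
    contour_integral (linepath (Complex (Re q) (Im p)) q) f +
    contour_integral (linepath q (Complex (Re p) (Im q))) f +
    contour_integral (linepath (Complex (Re p) (Im q)) p) f"
    (is "_ = contour_integral (linepath p ?r) f + _ + contour_integral (linepath q ?s) f + _")
proof -
  have "f contour_integrable_on linepath p ?r" "f contour_integrable_on linepath ?r q"
    "f contour_integrable_on linepath q ?s" "f contour_integrable_on linepath ?s p"
    by (auto simp: path_image_rectpath_segments
        intro!: contour_integrable_continuous_linepath continuous_on_subset[OF assms])
  then show ?thesis
    by (simp add: rectpath_def Let_def)
qed

lemma contour_integral_rectpath_bound:
  assumes "continuous_on (path_image (rectpath p q)) f" "B \<ge> 0"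
    and B: "\<And>z. z \<in> path_image (rectpath p q) \<Longrightarrow> cmod (f z) \<le> B"
  shows "cmod (contour_integral (rectpath p q) f) \<le> B * (2 * \<bar>Re q - Re p\<bar> + 2 * \<bar>Im q - Im p\<bar>)"
proof -
  have *: "cmod (contour_integral (linepath u v) f) \<le> B * cmod (v - u)"
    if "closed_segment u v \<subseteq> path_image (rectpath p q)" for u v
    using that assms
    by (intro contour_integral_bound_linepath contour_integrable_continuous_linepath)
       (auto intro: continuous_on_subset)
  let ?r = "Complex (Re q) (Im p)" and ?s = "Complex (Re p) (Im q)"
  have c: "cmod (?r - p) = \<bar>Re q - Re p\<bar>" "cmod (q - ?r) = \<bar>Im q - Im p\<bar>"
    "cmod (?s - q) = \<bar>Re q - Re p\<bar>" "cmod (p - ?s) = \<bar>Im q - Im p\<bar>"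
    by (simp_all add: cmod_def real_sqrt_abs abs_minus_commute)
  have s: "closed_segment p ?r \<subseteq> path_image (rectpath p q)"
    "closed_segment ?r q \<subseteq> path_image (rectpath p q)"
    "closed_segment q ?s \<subseteq> path_image (rectpath p q)"
    "closed_segment ?s p \<subseteq> path_image (rectpath p q)"
    unfolding path_image_rectpath_segments by blast+
  have tri: "cmod (w + x + y + z) \<le> cmod w + cmod x + cmod y + cmod z" for w x y z
    by (intro norm_triangle_le add_mono order_refl)
  show ?thesis
    unfolding contour_integral_rectpath[OF assms(1)]
    using order_trans[OF tri add_mono[OF add_mono[OF add_mono[OF *[OF s(1)] *[OF s(2)]] *[OF s(3)]] *[OF s(4)]]]
    unfolding c by (simp add: algebra_simps)
qed

text \<open>The variance is nonnegative: integrate (g - c)^2 with c the mean of g.\<close>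

lemma integral_square_le:
  fixes g :: "real \<Rightarrow> real"
  assumes "continuous_on {0..1} g"
  shows "(integral {0..1} g)\<^sup>2 \<le> integral {0..1} (\<lambda>x. (g x)\<^sup>2)"
proof -
  define c where "c = integral {0..1} g"
  have "(g has_integral c) {0..1}"
    unfolding c_def using assms by (intro integrable_integral integrable_continuous_real)
  moreover have "((\<lambda>x. (g x)\<^sup>2) has_integral integral {0..1} (\<lambda>x. (g x)\<^sup>2)) {0..1}"
    using assms by (intro integrable_integral integrable_continuous_real continuous_intros)
  moreover have "((\<lambda>x. c\<^sup>2) has_integral c\<^sup>2) {0..1 :: real}"
    using has_integral_const_real[of "c\<^sup>2" 0 1] by simp
  ultimately have "((\<lambda>x. (g x)\<^sup>2 - 2 * c * g x + c\<^sup>2) has_integral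
      (integral {0..1} (\<lambda>x. (g x)\<^sup>2) - 2 * c * c + c\<^sup>2)) {0..1}"
    by (intro has_integral_add has_integral_diff has_integral_mult_right)
  moreover have "(g x)\<^sup>2 - 2 * c * g x + c\<^sup>2 \<ge> 0" for x
    using zero_le_power2[of "g x - c"] by (simp add: power2_diff algebra_simps)
  ultimately have "0 \<le> integral {0..1} (\<lambda>x. (g x)\<^sup>2) - 2 * c * c + c\<^sup>2"
    by (rule has_integral_nonneg)
  then show ?thesis
    by (simp add: c_def power2_eq_square)
qed

lemma continuous_on_linepath_compose:
  assumes "continuous_on (closed_segment p q) f"
  shows "continuous_on {0..1} (\<lambda>x. f (linepath p q x))"
  using assms by (rule continuous_on_compose2) (auto simp: linepath_image_01 intro: continuous_on_linepath)

text \<open>With the square inside the integral, summation over sites can be carried out pointwise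
  in z, where the tail bounds hold.\<close>

lemma contour_integral_linepath_square_le:
  assumes "continuous_on (closed_segment p q) f"
  shows "(cmod (contour_integral (linepath p q) f))\<^sup>2 \<le>
    (cmod (q - p))\<^sup>2 * integral {0..1} (\<lambda>x. (cmod (f (linepath p q x)))\<^sup>2)"
proof -
  let ?f = "\<lambda>x. f (linepath p q x)"
  have cont: "continuous_on {0..1} ?f"
    by (rule continuous_on_linepath_compose[OF assms])
  have "contour_integral (linepath p q) f = integral {0..1} (\<lambda>x. ?f x * (q - p))"
    by (simp add: contour_integral_integral)
  also have "\<dots> = integral {0..1} ?f * (q - p)"
    by simp
  finally have "(cmod (contour_integral (linepath p q) f))\<^sup>2
      = (cmod (q - p))\<^sup>2 * (cmod (integral {0..1} ?f))\<^sup>2"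
    by (simp add: norm_mult power_mult_distrib)
  also have "cmod (integral {0..1} ?f) \<le> integral {0..1} (\<lambda>x. cmod (?f x))"
    using cont by (intro integral_norm_bound_integral integrable_continuous_real continuous_intros) auto
  then have "(cmod (integral {0..1} ?f))\<^sup>2 \<le> (integral {0..1} (\<lambda>x. cmod (?f x)))\<^sup>2"
    by (rule power_mono) simp
  also have "\<dots> \<le> integral {0..1} (\<lambda>x. (cmod (?f x))\<^sup>2)"
    using cont by (intro integral_square_le continuous_intros)
  finally show ?thesis
    by (simp add: mult_left_mono)
qed

section \<open>The contour representation of the evolution\<close>

context bounded_schroedinger
begin

text \<open>Only the upper side has variable height: for t > 0 the factor |exp (-i t z)| is at most
  1 below the real axis, so the lower side can stay at distance 1.\<close>

definition contour :: "real \<Rightarrow> real \<Rightarrow> complex" where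
  "contour h = rectpath (Complex (- a - 1) (- 1)) (Complex (a + 1) h)"

lemma valid_path_contour [simp]: "valid_path (contour h)"
  by (simp add: contour_def)

lemma path_image_contour:
  assumes "0 < h"
  shows "path_image (contour h) = {z. \<bar>Re z\<bar> = a + 1 \<and> Im z \<in> {-1..h}} \<union> {z. Im z \<in> {-1, h} \<and> \<bar>Re z\<bar> \<le> a + 1}"
  unfolding contour_def using assms a_nonneg by (subst path_image_rectpath) auto

text \<open>On the vertical sides c (a + 1) - |q| >= c because c a >= a; on the horizontal sides |Im
  z| >= h. The factor c serves to expand the contour to infinity.\<close>

lemma contour_dist:
  assumes "z \<in> path_image (contour h)" "0 < h" "h \<le> 1" "c \<ge> 1" "\<bar>q\<bar> \<le> a"
  shows "c * h \<le> cmod (of_real q - of_real c * z)"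
proof (cases "\<bar>Re z\<bar> = a + 1")
  case True
  have "c * h \<le> c * 1" using assms by (intro mult_left_mono) auto
  also have "c * 1 \<le> c * (a + 1) - \<bar>q\<bar>"
    using assms mult_right_mono[OF assms(4) a_nonneg] by (simp add: algebra_simps)
  also have "\<dots> = \<bar>c * Re z\<bar> - \<bar>q\<bar>"
    using assms True by (simp add: abs_mult)
  also have "\<dots> \<le> \<bar>Re (of_real q - of_real c * z)\<bar>" by simp
  also have "\<dots> \<le> cmod (of_real q - of_real c * z)" by (rule abs_Re_le_cmod)
  finally show ?thesis .
next
  case False
  then have "h \<le> \<bar>Im z\<bar>" using assms path_image_contour[of h] by auto
  then have "c * h \<le> \<bar>Im (of_real q - of_real c * z)\<bar>"
    using assms by (simp add: abs_mult)
  also have "\<dots> \<le> cmod (of_real q - of_real c * z)" by (rule abs_Im_le_cmod)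
  finally show ?thesis .
qed

lemma scaled_contour_off_spectrum:
  assumes "z \<in> path_image (contour h)" "0 < h" "h \<le> 1" "c \<ge> 1"
  shows "of_real c * z \<in> off_spectrum"
proof (rule ccontr)
  assume "of_real c * z \<notin> off_spectrum"
  then obtain q where "of_real c * z = of_real q" "\<bar>q\<bar> \<le> a"
    by (auto simp: off_spectrum_def)
  then have "c * h \<le> 0" using contour_dist[OF assms, of q] by simp
  then show False using assms by (simp add: mult_le_0_iff)
qed

lemma contour_off_spectrum:
  assumes "0 < h" "h \<le> 1"
  shows "path_image (contour h) \<subseteq> off_spectrum"
  using scaled_contour_off_spectrum[OF _ assms, of _ 1] by auto

lemma continuous_on_green: "continuous_on off_spectrum (\<lambda>z. green z n)"
  using holomorphic_green by (rule holomorphic_on_imp_continuous_on)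

text \<open>The contour can be blown up by any factor \<open>c \<ge> 1\<close>, where the integrand is of size \<open>1 / c\<^sup>2\<close>.\<close>

lemma contour_integral_tail:
  assumes h: "0 < h" "h \<le> 1"
  shows "contour_integral (contour h) (\<lambda>z. ell2_nth (H (res z (delta 0))) n / z) = 0"
proof -
  let ?f = "\<lambda>z. ell2_nth (H (res z (delta 0))) n / z"
  define big where "big c = rectpath (of_real c * Complex (- a - 1) (- 1)) (of_real c * Complex (a + 1) h)" for c
  have big: "big c x = of_real c * contour h x" for c x
    by (auto simp: big_def contour_def rectpath_def Let_def joinpaths_def linepath_def complex_eq_iff algebra_simps)
  have nz: "z \<noteq> 0" if "z \<in> off_spectrum" for z
    using that a_nonneg by (auto simp: off_spectrum_def)
  have hol: "?f holomorphic_on off_spectrum"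
  proof -
    have "(\<lambda>z. (green z (n + 1) + green z (n - 1) + of_real (V n) * green z n) / z) holomorphic_on off_spectrum"
      using nz by (intro holomorphic_intros holomorphic_green)
    then show ?thesis
      by (simp add: H_nth green_def)
  qed
  have img: "path_image (big c) = (\<lambda>z. of_real c * z) ` path_image (contour h)" for c
    by (auto simp: path_image_def big)
  have bound: "cmod (contour_integral (contour h) ?f) \<le> onorm H / h\<^sup>2 * (4 * (a + 1) + 2 * (h + 1)) / c"
    if c: "c \<ge> 1" for c
  proof -
    \<comment> \<open>The straight-line homotopy runs through multiples of the contour by factors
      between 1 and c, all of which avoid the interval.\<close>
    have "homotopic_loops off_spectrum (contour h) (big c)"
    proof (rule homotopic_loops_linear)
      fix x :: real assume x: "x \<in> {0..1}"
      show "closed_segment (contour h x) (big c x) \<subseteq> off_spectrum"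
      proof
        fix w assume "w \<in> closed_segment (contour h x) (big c x)"
        then obtain u where u: "0 \<le> u" "u \<le> 1" "w = (1 - u) *\<^sub>R contour h x + u *\<^sub>R big c x"
          by (auto simp: in_segment)
        then have "w = of_real (1 + u * (c - 1)) * contour h x"
          by (simp add: big scaleR_conv_of_real algebra_simps)
        moreover have "1 + u * (c - 1) \<ge> 1" using u c by simp
        moreover have "contour h x \<in> path_image (contour h)"
          using x by (simp add: path_image_def)
        ultimately show "w \<in> off_spectrum"
          using scaled_contour_off_spectrum[OF _ h, of "contour h x" "1 + u * (c - 1)"] by metis
      qed
    qed (simp_all add: contour_def big_def)
    then have "contour_integral (contour h) ?f = contour_integral (big c) ?f"
      by (rule Cauchy_theorem_homotopic_loops[OF _ open_off_spectrum hol]) (simp_all add: big_def)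
    also have "cmod \<dots> \<le> onorm H / (c * h)\<^sup>2 * (2 * \<bar>Re (of_real c * Complex (a + 1) h) - Re (of_real c * Complex (- a - 1) (- 1))\<bar>
        + 2 * \<bar>Im (of_real c * Complex (a + 1) h) - Im (of_real c * Complex (- a - 1) (- 1))\<bar>)"
      unfolding big_def
    proof (rule contour_integral_rectpath_bound, fold big_def)
      show "continuous_on (path_image (big c)) ?f"
        unfolding img using scaled_contour_off_spectrum h c
        by (intro continuous_on_subset[OF holomorphic_on_imp_continuous_on[OF hol]]) auto
      show "0 \<le> onorm H / (c * h)\<^sup>2"
        using onorm_pos_le[OF H.bounded_linear_axioms] by simp
      fix w assume "w \<in> path_image (big c)"
      then obtain z where z: "z \<in> path_image (contour h)" "w = of_real c * z"
        unfolding img by blast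
      have ch: "c * h > 0" using c h by simp
      have "c * h \<le> cmod (of_real 0 - w)"
        unfolding z(2) by (rule contour_dist[OF z(1) h c]) (simp add: a_nonneg)
      then have w: "c * h \<le> cmod w" by simp
      have "c * h * norm (res w (delta 0)) \<le> norm (delta 0 :: int ell2)"
      proof (rule norm_res_le)
        show "w \<in> off_spectrum" unfolding z(2) by (rule scaled_contour_off_spectrum[OF z(1) h c])
        show "c * h \<le> cmod (of_real q - w)" if "\<bar>q\<bar> \<le> a" for q
          unfolding z(2) by (rule contour_dist[OF z(1) h c that])
      qed
      then have r: "norm (res w (delta 0)) \<le> 1 / (c * h)"
        using ch by (simp add: norm_delta field_simps)
      have "cmod (ell2_nth (H (res w (delta 0))) n) \<le> norm (H (res w (delta 0)))"
        by (rule cmod_ell2_nth_le_norm)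
      also have "\<dots> \<le> onorm H * norm (res w (delta 0))"
        by (rule onorm[OF H.bounded_linear_axioms])
      also have "\<dots> \<le> onorm H * (1 / (c * h))"
        by (intro mult_left_mono r onorm_pos_le[OF H.bounded_linear_axioms])
      finally have "cmod (?f w) \<le> onorm H * (1 / (c * h)) / (c * h)"
        unfolding norm_divide using w ch onorm_pos_le[OF H.bounded_linear_axioms] by (intro frac_le) auto
      then show "cmod (?f w) \<le> onorm H / (c * h)\<^sup>2"
        by (simp add: power2_eq_square mult.assoc)
    qed
    \<comment> \<open>The length grows like c against an integrand of order 1 / c^2, leaving 1 /
      c.\<close>
    also have "\<dots> = onorm H / h\<^sup>2 * (4 * (a + 1) + 2 * (h + 1)) / c"
    proof -
      have "\<bar>c * (a + 1) + c * (1 + a)\<bar> = c * (2 * (a + 1))" "\<bar>c * h + c\<bar> = c * (h + 1)"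
        using c h a_nonneg by (simp_all add: algebra_simps)
      moreover have "Re (of_real c * Complex (a + 1) h) - Re (of_real c * Complex (- a - 1) (- 1))
          = c * (a + 1) + c * (1 + a)" "Im (of_real c * Complex (a + 1) h) - Im (of_real c * Complex (- a - 1) (- 1)) = c * h + c"
        by (simp_all add: algebra_simps)
      ultimately show ?thesis
        using c h by (simp only:) (simp add: field_simps power2_eq_square)
    qed
    finally show ?thesis .
  qed
  have "cmod (contour_integral (contour h) ?f) \<le> 0"
  proof (rule tendsto_lowerbound)
    show "((\<lambda>c. onorm H / h\<^sup>2 * (4 * (a + 1) + 2 * (h + 1)) / c) \<longlongrightarrow> 0) at_top"
      by (intro tendsto_divide_0[OF tendsto_const] filterlim_at_top_imp_at_infinity filterlim_ident)
    show "\<forall>\<^sub>F c in at_top. cmod (contour_integral (contour h) ?f) \<le> onorm H / h\<^sup>2 * (4 * (a + 1) + 2 * (h + 1)) / c"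
      using bound by (auto simp: eventually_at_top_linorder)
  qed simp
  then show ?thesis by simp
qed

text \<open>For k = 0 the resolvent equation writes the Green function as a part of order 1 / z^2,
  whose integral vanishes, minus \<open>delta 0\<close> / z, whose residue gives the value.
  Multiplying the Green equation by z^k raises k by one; its source term is then a polynomial and
  integrates to zero.\<close>

lemma has_contour_integral_green_moment:
  assumes h: "0 < h" "h \<le> 1"
  shows "((\<lambda>z. z ^ k * green z n) has_contour_integral - 2 * pi * \<i> * ell2_nth ((H ^^ k) (delta 0)) n) (contour h)"
proof (induction k arbitrary: n)
  case 0
  have img: "path_image (contour h) \<subseteq> off_spectrum" by (rule contour_off_spectrum[OF h])
  have nz: "z \<noteq> 0" if "z \<in> off_spectrum" for z
    using that a_nonneg by (auto simp: off_spectrum_def)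
  have "winding_number (contour h) 0 = 1"
    unfolding contour_def using a_nonneg h by (intro winding_number_rectpath) (simp add: in_box_complex_iff)
  then have 1: "((\<lambda>w. 1 / w) has_contour_integral 2 * pi * \<i>) (contour h)"
    using has_contour_integral_winding_number[OF valid_path_contour, of 0 h] nz img by auto
  let ?f = "\<lambda>z. ell2_nth (H (res z (delta 0))) n / z"
  have "?f contour_integrable_on contour h"
  proof (rule contour_integrable_holomorphic_simple[OF _ open_off_spectrum _ img])
    have "(\<lambda>z. (green z (n + 1) + green z (n - 1) + of_real (V n) * green z n) / z) holomorphic_on off_spectrum"
      using nz by (intro holomorphic_intros holomorphic_green)
    then show "?f holomorphic_on off_spectrum"
      by (simp add: H_nth green_def)
  qed simp
  then have 2: "(?f has_contour_integral 0) (contour h)"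
    using has_contour_integral_integral[of ?f "contour h"] contour_integral_tail[OF h, of n] by simp
  let ?d = "if n = 0 then 1 else 0 :: complex"
  have "((\<lambda>z. ?f z - ?d * (1 / z)) has_contour_integral (0 - ?d * (2 * pi * \<i>))) (contour h)"
    by (intro has_contour_integral_diff has_contour_integral_lmul 1 2)
  moreover have "?f z - ?d * (1 / z) = z ^ 0 * green z n" if "z \<in> path_image (contour h)" for z
  proof -
    have z: "z \<in> off_spectrum" "z \<noteq> 0" using img nz that by auto
    have "ell2_nth (H (res z (delta 0))) n = z * green z n + ?d"
      using green_equation[OF z(1), of n] by (simp add: H_nth green_def)
    then show ?thesis using z(2) by (simp add: field_simps)
  qed
  ultimately have "((\<lambda>z. z ^ 0 * green z n) has_contour_integral (0 - ?d * (2 * pi * \<i>))) (contour h)"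
    by (rule has_contour_integral_eq)
  then show ?case
    by (cases "n = 0") (simp_all add: ell2_nth_delta)
next
  case (Suc k)
  have img: "path_image (contour h) \<subseteq> off_spectrum" by (rule contour_off_spectrum[OF h])
  let ?d = "if n = 0 then 1 else 0 :: complex"
  have "((\<lambda>z. z ^ k * ?d) has_contour_integral 0) (contour h)"
    by (rule Cauchy_theorem_convex_simple[of _ UNIV]) (auto simp: contour_def intro!: holomorphic_intros)
  from has_contour_integral_diff[OF has_contour_integral_add[OF has_contour_integral_add[OF Suc[of "n + 1"] Suc[of "n - 1"]]
        has_contour_integral_lmul[OF Suc[of n], of "of_real (V n)"]] this]
  have "((\<lambda>z. z ^ k * green z (n + 1) + z ^ k * green z (n - 1) + of_real (V n) * (z ^ k * green z n) - z ^ k * ?d)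
      has_contour_integral - 2 * pi * \<i> * ell2_nth ((H ^^ k) (delta 0)) (n + 1)
        + - 2 * pi * \<i> * ell2_nth ((H ^^ k) (delta 0)) (n - 1)
        + of_real (V n) * (- 2 * pi * \<i> * ell2_nth ((H ^^ k) (delta 0)) n) - 0) (contour h)"
    by assumption
  moreover have "- 2 * pi * \<i> * ell2_nth ((H ^^ k) (delta 0)) (n + 1)
        + - 2 * pi * \<i> * ell2_nth ((H ^^ k) (delta 0)) (n - 1)
        + of_real (V n) * (- 2 * pi * \<i> * ell2_nth ((H ^^ k) (delta 0)) n) - 0
      = - 2 * pi * \<i> * ell2_nth ((H ^^ Suc k) (delta 0)) n"
    by (simp add: H_nth algebra_simps)
  ultimately have "((\<lambda>z. z ^ k * green z (n + 1) + z ^ k * green z (n - 1) + of_real (V n) * (z ^ k * green z n) - z ^ k * ?d)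
      has_contour_integral - 2 * pi * \<i> * ell2_nth ((H ^^ Suc k) (delta 0)) n) (contour h)"
    by (simp only:)
  then show ?case
  proof (rule has_contour_integral_eq)
    fix z assume "z \<in> path_image (contour h)"
    then have "z \<in> off_spectrum" using img by blast
    from arg_cong[OF green_equation[OF this, of n], of "\<lambda>x. z ^ k * x"]
    show "z ^ k * green z (n + 1) + z ^ k * green z (n - 1) + of_real (V n) * (z ^ k * green z n) - z ^ k * ?d
      = z ^ Suc k * green z n"
      by (simp add: algebra_simps)
  qed
qed

section \<open>From moments to the evolution\<close>

lemma evolution_nth_sums:
  "(\<lambda>k. (- \<i> * of_real t) ^ k / fact k * ell2_nth ((H ^^ k) u) n) sums ell2_nth (evolution V t u) n"
proof -
  let ?A = "\<lambda>u. (- \<i> * of_real t) *\<^sub>C H u"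
  have A: "bounded_linear ?A"
  proof (rule bounded_linear_intro)
    show "?A (x + y) = ?A x + ?A y" for x y
      by (simp add: H.add scaleC_add_right)
    show "?A (r *\<^sub>R x) = r *\<^sub>R ?A x" for r x
      by (rule ell2_eqI) (simp add: H.scaleR ell2_nth_simps scaleR_conv_of_real)
    show "norm (?A x) \<le> norm x * (\<bar>t\<bar> * onorm H)" for x
      using mult_left_mono[OF onorm[OF H.bounded_linear_axioms, of x], of "\<bar>t\<bar>"]
      by (simp add: norm_scaleC norm_mult mult_ac)
  qed
  have pow: "(?A ^^ k) u = ((- \<i> * of_real t) ^ k) *\<^sub>C (H ^^ k) u" for k
  proof (induction k)
    case 0
    show ?case by (simp add: scaleC_one)
  next
    case (Suc k)
    show ?case
      by (simp only: funpow.simps o_apply Suc schroedinger_scaleC[OF bounded_V] scaleC_scaleC power_Suc)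
  qed
  have "(\<lambda>k. (?A ^^ k) u /\<^sub>R fact k) sums evolution V t u"
    unfolding evolution_def op_exp_def by (rule summable_sums[OF summable_op_exp[OF A]])
  then have "(\<lambda>k. ell2_nth ((?A ^^ k) u /\<^sub>R fact k) n) sums ell2_nth (evolution V t u) n"
    by (rule bounded_linear.sums[OF bounded_linear_ell2_nth])
  moreover have "ell2_nth ((?A ^^ k) u /\<^sub>R fact k) n
      = (- \<i> * of_real t) ^ k / fact k * ell2_nth ((H ^^ k) u) n" for k
    unfolding pow by (simp add: ell2_nth_scaleR ell2_nth_scaleC scaleR_conv_of_real field_simps)
  ultimately show ?thesis by (simp only:)
qed

text \<open>The moments match the partial sums of the scalar exponential under the integral with
  those of the operator exponential. The Weierstrass test on the compact contour permits the
  limit.\<close>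

lemma contour_integral_exp_green:
  assumes h: "0 < h" "h \<le> 1"
  shows "contour_integral (contour h) (\<lambda>z. exp (- \<i> * of_real t * z) * green z n)
    = - 2 * pi * \<i> * ell2_nth (evolution V t (delta 0)) n"
proof -
  let ?\<Gamma> = "path_image (contour h)"
  let ?s = "- \<i> * complex_of_real t"
  let ?S = "\<lambda>M z. \<Sum>k<M. (?s * z) ^ k / fact k * green z n"
  let ?F = "\<lambda>z. exp (?s * z) * green z n"
  have img: "?\<Gamma> \<subseteq> off_spectrum" by (rule contour_off_spectrum[OF h])
  have cg: "continuous_on ?\<Gamma> (\<lambda>z. green z n)"
    using continuous_on_green img by (rule continuous_on_subset)
  have comp: "compact ?\<Gamma>" by (simp add: compact_path_image contour_def)
  obtain R where R: "\<And>z. z \<in> ?\<Gamma> \<Longrightarrow> cmod z \<le> R"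
    using compact_imp_bounded[OF comp] by (auto simp: bounded_iff)
  obtain G where G: "\<And>z. z \<in> ?\<Gamma> \<Longrightarrow> cmod (green z n) \<le> G"
    using compact_imp_bounded[OF compact_continuous_image[OF cg comp]] by (auto simp: bounded_iff)
  have unif: "uniform_limit ?\<Gamma> ?S ?F sequentially"
  proof -
    have "uniform_limit ?\<Gamma> ?S (\<lambda>z. \<Sum>k. (?s * z) ^ k / fact k * green z n) sequentially"
    proof (rule Weierstrass_m_test)
      show "summable (\<lambda>k. inverse (fact k) * (\<bar>t\<bar> * \<bar>R\<bar>) ^ k * \<bar>G\<bar>)"
        by (intro summable_mult2 summable_exp)
      fix k z assume z: "z \<in> ?\<Gamma>"
      have "(cmod (?s * z)) ^ k \<le> (\<bar>t\<bar> * \<bar>R\<bar>) ^ k"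
        using R[OF z] by (intro power_mono) (auto simp: norm_mult intro!: mult_left_mono)
      then show "norm ((?s * z) ^ k / fact k * green z n) \<le> inverse (fact k) * (\<bar>t\<bar> * \<bar>R\<bar>) ^ k * \<bar>G\<bar>"
      proof -
        assume *: "(cmod (?s * z)) ^ k \<le> (\<bar>t\<bar> * \<bar>R\<bar>) ^ k"
        have "norm ((?s * z) ^ k / fact k * green z n) = inverse (fact k) * cmod (?s * z) ^ k * cmod (green z n)"
          by (simp add: norm_mult norm_power norm_divide power_mult_distrib divide_inverse norm_inverse)
        also have "\<dots> \<le> inverse (fact k) * (\<bar>t\<bar> * \<bar>R\<bar>) ^ k * \<bar>G\<bar>"
          using * G[OF z] by (intro mult_mono mult_left_mono) auto
        finally show ?thesis .
      qed
    qed
    moreover have "(\<Sum>k. (?s * z) ^ k / fact k * green z n) = ?F z" for z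
      using exp_converges[of "?s * z"]
      by (intro sums_unique[symmetric] sums_mult2) (simp add: scaleR_conv_of_real divide_inverse mult.commute)
    ultimately show ?thesis by simp
  qed
  have S: "contour_integral (contour h) (?S M)
      = - 2 * pi * \<i> * (\<Sum>k<M. ?s ^ k / fact k * ell2_nth ((H ^^ k) (delta 0)) n)" for M
  proof -
    let ?T = "\<lambda>z. \<Sum>k<M. ?s ^ k / fact k * (z ^ k * green z n)"
    have "(?T has_contour_integral
        (\<Sum>k<M. ?s ^ k / fact k * (- 2 * pi * \<i> * ell2_nth ((H ^^ k) (delta 0)) n))) (contour h)"
    proof (rule has_contour_integral_sum)
      show "((\<lambda>z. ?s ^ k / fact k * (z ^ k * green z n)) has_contour_integral
        ?s ^ k / fact k * (- 2 * pi * \<i> * ell2_nth ((H ^^ k) (delta 0)) n)) (contour h)" for k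
        by (rule has_contour_integral_lmul, rule has_contour_integral_green_moment[OF h])
    qed simp
    moreover have "?S M = ?T"
      by (intro ext sum.cong refl) (simp only: power_mult_distrib times_divide_eq_left mult.assoc)
    moreover have "(\<Sum>k<M. ?s ^ k / fact k * (- 2 * pi * \<i> * ell2_nth ((H ^^ k) (delta 0)) n))
      = - 2 * pi * \<i> * (\<Sum>k<M. ?s ^ k / fact k * ell2_nth ((H ^^ k) (delta 0)) n)"
      unfolding sum_distrib_left by (intro sum.cong refl mult.left_commute)
    ultimately show ?thesis
      by (simp only: contour_integral_unique)
  qed
  let ?L = "2 * \<bar>Re (Complex (a + 1) h) - Re (Complex (- a - 1) (- 1))\<bar>
    + 2 * \<bar>Im (Complex (a + 1) h) - Im (Complex (- a - 1) (- 1))\<bar>"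
  have L: "?L > 0" using h a_nonneg by simp
  have hF: "?F holomorphic_on off_spectrum"
    by (intro holomorphic_intros holomorphic_green)
  have hS: "?S M holomorphic_on off_spectrum" for M
    by (intro holomorphic_intros holomorphic_green) simp_all
  have hD: "(\<lambda>z. ?S M z - ?F z) holomorphic_on off_spectrum" for M
    by (intro holomorphic_on_diff hF hS)
  have "(\<lambda>M. contour_integral (contour h) (?S M)) \<longlonglongrightarrow> contour_integral (contour h) ?F"
  proof (rule tendstoI)
    fix e :: real assume "e > 0"
    then have "e / (2 * ?L) > 0" using L by simp
    from uniform_limitD[OF unif this]
    show "\<forall>\<^sub>F M in sequentially. dist (contour_integral (contour h) (?S M)) (contour_integral (contour h) ?F) < e"
    proof eventually_elim
      case (elim M)
      have "?S M contour_integrable_on contour h" "?F contour_integrable_on contour h"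
        by (rule contour_integrable_holomorphic_simple[OF hS open_off_spectrum valid_path_contour img]
            contour_integrable_holomorphic_simple[OF hF open_off_spectrum valid_path_contour img])+
      then have "contour_integral (contour h) (?S M) - contour_integral (contour h) ?F
          = contour_integral (contour h) (\<lambda>z. ?S M z - ?F z)"
        by (rule contour_integral_diff[symmetric])
      also have "cmod \<dots> \<le> e / (2 * ?L) * ?L"
        unfolding contour_def
      proof (rule contour_integral_rectpath_bound, fold contour_def)
        show "continuous_on ?\<Gamma> (\<lambda>z. ?S M z - ?F z)"
          by (rule continuous_on_subset[OF holomorphic_on_imp_continuous_on[OF hD] img])
        show "0 \<le> e / (2 * ?L)" using \<open>e / (2 * ?L) > 0\<close> by (rule less_imp_le)
        show "cmod (?S M z - ?F z) \<le> e / (2 * ?L)" if "z \<in> ?\<Gamma>" for z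
          using elim that by (auto simp: dist_norm less_imp_le)
      qed
      also have "\<dots> < e"
      proof -
        have "e / (2 * l) * l < e" if "l > 0" for l using that \<open>e > 0\<close> by simp
        then show ?thesis using L .
      qed
      finally show ?case unfolding dist_norm .
    qed
  qed
  moreover have "(\<lambda>M. contour_integral (contour h) (?S M)) \<longlonglongrightarrow> - 2 * pi * \<i> * ell2_nth (evolution V t (delta 0)) n"
    unfolding S by (rule tendsto_mult_left) (rule evolution_nth_sums[unfolded sums_def])
  ultimately show ?thesis by (rule LIMSEQ_unique)
qed

end

section \<open>The outside probabilities\<close>

context bounded_schroedinger
begin

text \<open>t h <= 1 bounds the squared exponential factor by exp 2 on the whole contour, and 4 (a +
  1)^2 dominates the squared length of any side.\<close>

lemma contour_integral_exp_square_le: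
  assumes t: "t > 0" and h: "h > 0" "h \<le> 1" "t * h \<le> 1"
    and seg: "closed_segment p q \<subseteq> path_image (contour h)"
    and pq: "cmod (q - p) \<le> 2 * (a + 1)"
    and F: "finite F"
    and G: "continuous_on {0..1} G"
      "\<And>x. x \<in> {0..1} \<Longrightarrow> (\<Sum>n\<in>F. (cmod (green (linepath p q x) n))\<^sup>2) \<le> G x"
  shows "(\<Sum>n\<in>F. (cmod (contour_integral (linepath p q) (\<lambda>z. exp (- \<i> * of_real t * z) * green z n)))\<^sup>2)
    \<le> 4 * (a + 1)\<^sup>2 * (exp 2 * integral {0..1} G)"
proof -
  let ?f = "\<lambda>n z. exp (- \<i> * of_real t * z) * green z n"
  have "closed_segment p q \<subseteq> off_spectrum"
    using seg contour_off_spectrum[OF h(1,2)] by blast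
  then have cg: "continuous_on (closed_segment p q) (\<lambda>z. green z n)" for n
    by (rule continuous_on_subset[OF continuous_on_green])
  have cont: "continuous_on (closed_segment p q) (?f n)" for n
    by (intro continuous_intros cg)
  have ci: "(\<lambda>x. (cmod (?f n (linepath p q x)))\<^sup>2) integrable_on {0..1}" for n
    by (intro integrable_continuous_real continuous_intros continuous_on_linepath_compose cont)
  have "(\<Sum>n\<in>F. (cmod (contour_integral (linepath p q) (?f n)))\<^sup>2)
      \<le> (\<Sum>n\<in>F. (cmod (q - p))\<^sup>2 * integral {0..1} (\<lambda>x. (cmod (?f n (linepath p q x)))\<^sup>2))"
    by (intro sum_mono contour_integral_linepath_square_le cont)
  also have "\<dots> = (cmod (q - p))\<^sup>2 * integral {0..1} (\<lambda>x. \<Sum>n\<in>F. (cmod (?f n (linepath p q x)))\<^sup>2)"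
    by (simp only: sum_distrib_left[symmetric] integral_sum[OF F ci])
  also have "\<dots> \<le> (2 * (a + 1))\<^sup>2 * integral {0..1} (\<lambda>x. exp 2 * G x)"
  proof (rule mult_mono)
    show "(cmod (q - p))\<^sup>2 \<le> (2 * (a + 1))\<^sup>2"
      using pq by (rule power_mono) simp
    show "integral {0..1} (\<lambda>x. \<Sum>n\<in>F. (cmod (?f n (linepath p q x)))\<^sup>2) \<le> integral {0..1} (\<lambda>x. exp 2 * G x)"
    proof (rule integral_le)
      show "(\<lambda>x. \<Sum>n\<in>F. (cmod (?f n (linepath p q x)))\<^sup>2) integrable_on {0..1}"
        by (intro integrable_sum F ci)
      show "(\<lambda>x. exp 2 * G x) integrable_on {0..1}"
        using G(1) by (intro integrable_continuous_real continuous_intros)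
      fix x :: real assume x: "x \<in> {0..1}"
      let ?z = "linepath p q x"
      have "?z \<in> path_image (contour h)"
        by (rule subsetD[OF seg linepath_in_path[OF x]])
      then have "Im ?z \<le> h"
        using path_image_contour[OF h(1)] h by auto
      then have "t * Im ?z \<le> t * h"
        using t by (intro mult_left_mono) auto
      then have "t * Im ?z \<le> 1" using h by simp
      then have "(exp (t * Im ?z))\<^sup>2 \<le> exp 2"
        by (simp flip: exp_double)
      then have e: "(cmod (exp (- \<i> * of_real t * ?z)))\<^sup>2 \<le> exp 2"
        by (simp add: norm_exp_eq_Re)
      have "(\<Sum>n\<in>F. (cmod (?f n ?z))\<^sup>2)
          = (cmod (exp (- \<i> * of_real t * ?z)))\<^sup>2 * (\<Sum>n\<in>F. (cmod (green ?z n))\<^sup>2)"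
        by (simp only: norm_mult[of "exp _"] power_mult_distrib sum_distrib_left)
      also have "\<dots> \<le> exp 2 * G x"
        by (intro mult_mono e G(2) x sum_nonneg) auto
      finally show "(\<Sum>n\<in>F. (cmod (?f n ?z))\<^sup>2) \<le> exp 2 * G x" .
    qed
    show "0 \<le> integral {0..1} (\<lambda>x. \<Sum>n\<in>F. (cmod (?f n (linepath p q x)))\<^sup>2)"
      by (intro integral_nonneg integrable_sum F ci sum_nonneg) auto
  qed simp
  finally show ?thesis
    unfolding power_mult_distrib by simp
qed

text \<open>The majorant \<open>G\<close> on the upper side is left open: it will come from the
  transfer matrices if t >= 1 and from the decay estimate if t < 1.\<close>

lemma sum_evolution_le:
  assumes t: "t > 0" and h: "h > 0" "h \<le> 1" "t * h \<le> 1"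
    and F: "finite F" "\<And>n. n \<in> F \<Longrightarrow> int N \<le> \<bar>n\<bar>"
    and G: "continuous_on {-(a + 1)..a + 1} G"
      "\<And>E. \<bar>E\<bar> \<le> a + 1 \<Longrightarrow> (\<Sum>n\<in>F. (cmod (green (Complex E h) n))\<^sup>2) \<le> G E"
  shows "(\<Sum>n\<in>F. (cmod (ell2_nth (evolution V t (delta 0)) n))\<^sup>2) \<le>
    exp 2 * (192 * (a + 1)\<^sup>2 * (16 / 25) ^ N + 8 * (a + 1) * integral {-(a + 1)..a + 1} G)"
proof -
  define K where "K = a + 1"
  have K: "K \<ge> 1" using a_nonneg by (simp add: K_def)
  define p q r s where "p = Complex (-K) (-1)" and "q = Complex K h" and "r = Complex K (-1)" and "s = Complex (-K) h"
  let ?f = "\<lambda>n z. exp (- \<i> * of_real t * z) * green z n"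
  let ?I = "\<lambda>u v n. contour_integral (linepath u v) (?f n)"
  have contour: "contour h = rectpath p q"
    by (simp add: contour_def p_def q_def K_def)
  have segs: "closed_segment p r \<subseteq> path_image (contour h)" "closed_segment r q \<subseteq> path_image (contour h)"
    "closed_segment q s \<subseteq> path_image (contour h)" "closed_segment s p \<subseteq> path_image (contour h)"
    unfolding contour path_image_rectpath_segments p_def q_def r_def s_def complex.sel by blast+
  have lens: "cmod (r - p) \<le> 2 * (a + 1)" "cmod (q - r) \<le> 2 * (a + 1)"
    "cmod (s - q) \<le> 2 * (a + 1)" "cmod (p - s) \<le> 2 * (a + 1)"
    using K h by (simp_all add: p_def q_def r_def s_def cmod_eq_Re cmod_eq_Im K_def[symmetric])
  have far: "(\<Sum>n\<in>F. (cmod (?I u v n))\<^sup>2) \<le> 4 * K\<^sup>2 * (exp 2 * (4 * (16 / 25) ^ N))"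
    if seg: "closed_segment u v \<subseteq> path_image (contour h)" and len: "cmod (v - u) \<le> 2 * (a + 1)"
      and far: "\<And>z. z \<in> closed_segment u v \<Longrightarrow> \<bar>Re z\<bar> = K \<or> Im z = - 1" for u v
  proof -
    have "(\<Sum>n\<in>F. (cmod (?I u v n))\<^sup>2) \<le> 4 * (a + 1)\<^sup>2 * (exp 2 * integral {0..1} (\<lambda>x::real. 4 * (16 / 25) ^ N))"
    proof (rule contour_integral_exp_square_le[OF t h seg len F(1)])
      fix x :: real assume "x \<in> {0..1}"
      then have z: "linepath u v x \<in> closed_segment u v"
        by (simp add: linepath_in_path)
      show "(\<Sum>n\<in>F. (cmod (green (linepath u v x) n))\<^sup>2) \<le> 4 * (16 / 25) ^ N"
      proof (rule green_decay)
        show "linepath u v x \<in> off_spectrum"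
          using z seg contour_off_spectrum[OF h(1,2)] by blast
        show "1 \<le> cmod (of_real b - linepath u v x)" if b: "\<bar>b\<bar> \<le> a" for b
        proof -
          have "1 \<le> \<bar>Re (of_real b - linepath u v x)\<bar> \<or> 1 \<le> \<bar>Im (of_real b - linepath u v x)\<bar>"
            using far[OF z] b by (auto simp: K_def)
          then show ?thesis
            by (elim disjE) (erule order_trans, rule abs_Re_le_cmod abs_Im_le_cmod)+
        qed
      qed (use F in auto)
    qed simp
    then show ?thesis by (simp add: K_def)
  qed
  have seg_Im: "Im z = Im u" if seg: "z \<in> closed_segment u v" and "Im u = Im v" for u v z
  proof -
    obtain x where x: "z = (1 - x) *\<^sub>R u + x *\<^sub>R v" using seg by (auto simp: in_segment)
    show ?thesis unfolding x using \<open>Im u = Im v\<close> by (simp add: algebra_simps)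
  qed
  have seg_Re: "Re z = Re u" if seg: "z \<in> closed_segment u v" and "Re u = Re v" for u v z
  proof -
    obtain x where x: "z = (1 - x) *\<^sub>R u + x *\<^sub>R v" using seg by (auto simp: in_segment)
    show ?thesis unfolding x using \<open>Re u = Re v\<close> by (simp add: algebra_simps)
  qed
  have side1: "(\<Sum>n\<in>F. (cmod (?I p r n))\<^sup>2) \<le> 4 * K\<^sup>2 * (exp 2 * (4 * (16 / 25) ^ N))"
  proof (rule far[OF segs(1) lens(1)])
    show "\<bar>Re z\<bar> = K \<or> Im z = - 1" if "z \<in> closed_segment p r" for z
      using seg_Im[OF that] K by (simp add: p_def r_def)
  qed
  have side2: "(\<Sum>n\<in>F. (cmod (?I r q n))\<^sup>2) \<le> 4 * K\<^sup>2 * (exp 2 * (4 * (16 / 25) ^ N))"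
  proof (rule far[OF segs(2) lens(2)])
    show "\<bar>Re z\<bar> = K \<or> Im z = - 1" if "z \<in> closed_segment r q" for z
      using seg_Re[OF that] K by (simp add: q_def r_def)
  qed
  have side4: "(\<Sum>n\<in>F. (cmod (?I s p n))\<^sup>2) \<le> 4 * K\<^sup>2 * (exp 2 * (4 * (16 / 25) ^ N))"
  proof (rule far[OF segs(4) lens(4)])
    show "\<bar>Re z\<bar> = K \<or> Im z = - 1" if "z \<in> closed_segment s p" for z
      using seg_Re[OF that] K by (simp add: p_def s_def)
  qed
  have side3: "(\<Sum>n\<in>F. (cmod (?I q s n))\<^sup>2) \<le> 4 * K\<^sup>2 * (exp 2 * (integral {-K..K} G / (2 * K)))"
  proof -
    have "(G has_integral integral {-K..K} G) (cbox (-K) K)"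
      using G(1) by (auto simp: K_def intro!: integrable_integral integrable_continuous_real)
    \<comment> \<open>The upper side is traversed from right to left, so E = K - 2 K x.\<close>
    from has_integral_affinity[OF this, of "- (2 * K)" K]
    have "((\<lambda>x. G (- (2 * K) * x + K)) has_integral (1 / (2 * K)) * integral {-K..K} G)
        ((\<lambda>x. (1 / - (2 * K)) * x + - ((1 / - (2 * K)) * K)) ` {-K..K})"
      using K unfolding cbox_interval by simp
    also have "(\<lambda>x. (1 / - (2 * K)) * x + - ((1 / - (2 * K)) * K)) ` {-K..K} = {0..1}"
    proof -
      have "(\<lambda>x. (1 / - (2 * K)) * x + - ((1 / - (2 * K)) * K)) = (\<lambda>x. (1 / - (2 * K)) * x + 1 / 2)"
        using K by auto
      then show ?thesis
        using K by (simp only: image_affinity_atLeastAtMost) (simp add: field_simps)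
    qed
    finally have int: "integral {0..1} (\<lambda>x. G (- (2 * K) * x + K)) = integral {-K..K} G / (2 * K)"
      by (simp add: integral_unique)
    have range: "\<bar>- (2 * K) * x + K\<bar> \<le> K" if "x \<in> {0..1}" for x
      using that K mult_left_mono[of x 1 "2 * K"] by (simp add: abs_le_iff)
    have "(\<Sum>n\<in>F. (cmod (?I q s n))\<^sup>2)
      \<le> 4 * (a + 1)\<^sup>2 * (exp 2 * integral {0..1} (\<lambda>x. G (- (2 * K) * x + K)))"
    proof (rule contour_integral_exp_square_le[OF t h segs(3) lens(3) F(1)])
      show "continuous_on {0..1} (\<lambda>x. G (- (2 * K) * x + K))"
      proof (rule continuous_on_compose2[OF G(1)])
        show "(\<lambda>x. - (2 * K) * x + K) ` {0..1} \<subseteq> {- (a + 1)..a + 1}"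
          unfolding K_def[symmetric]
        proof (intro image_subsetI)
          show "- (2 * K) * x + K \<in> {-K..K}" if "x \<in> {0..1}" for x
            using range[OF that] unfolding atLeastAtMost_iff abs_le_iff by linarith
        qed
      qed (intro continuous_intros)
      fix x :: real assume x: "x \<in> {0..1}"
      have "linepath q s x = Complex (- (2 * K) * x + K) h"
        by (simp add: linepath_def q_def s_def complex_eq_iff algebra_simps)
      then show "(\<Sum>n\<in>F. (cmod (green (linepath q s x) n))\<^sup>2) \<le> G (- (2 * K) * x + K)"
        using G(2) range[OF x] by (simp add: K_def)
    qed
    then show ?thesis unfolding int K_def[symmetric] .
  qed
  have "cmod (ell2_nth (evolution V t (delta 0)) n) \<le>
      cmod (?I p r n) + cmod (?I r q n) + cmod (?I q s n) + cmod (?I s p n)" for n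
  proof -
    have cont: "continuous_on (path_image (rectpath p q)) (?f n)"
      unfolding contour[symmetric] using continuous_on_subset[OF continuous_on_green contour_off_spectrum[OF h(1,2)]]
      by (intro continuous_intros)
    have "- 2 * pi * \<i> * ell2_nth (evolution V t (delta 0)) n = ?I p r n + ?I r q n + ?I q s n + ?I s p n"
      using contour_integral_exp_green[OF h(1,2), of t n] contour_integral_rectpath[OF cont]
      by (simp add: contour p_def q_def r_def s_def)
    then have "cmod (- 2 * pi * \<i> * ell2_nth (evolution V t (delta 0)) n)
        \<le> cmod (?I p r n) + cmod (?I r q n) + cmod (?I q s n) + cmod (?I s p n)"
      by (simp only:) (intro norm_triangle_le add_mono order_refl)
    \<comment> \<open>The prefactor 1 / (2 pi) is simply estimated by 1.\<close>
    moreover have "1 * cmod (ell2_nth (evolution V t (delta 0)) n)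
        \<le> (2 * pi) * cmod (ell2_nth (evolution V t (delta 0)) n)"
      using pi_ge_two by (intro mult_right_mono) auto
    ultimately show ?thesis by (simp add: norm_mult)
  qed
  then have sq: "(cmod (ell2_nth (evolution V t (delta 0)) n))\<^sup>2 \<le>
      4 * ((cmod (?I p r n))\<^sup>2 + (cmod (?I r q n))\<^sup>2 + (cmod (?I q s n))\<^sup>2 + (cmod (?I s p n))\<^sup>2)" for n
  proof -
    have sq4: "(w + x + y + z)\<^sup>2 \<le> 4 * (w\<^sup>2 + x\<^sup>2 + y\<^sup>2 + z\<^sup>2)" for w x y z :: real
      using zero_le_power2[of "w - x"] zero_le_power2[of "w - y"] zero_le_power2[of "w - z"]
        zero_le_power2[of "x - y"] zero_le_power2[of "x - z"] zero_le_power2[of "y - z"]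
      unfolding power2_eq_square by (simp add: algebra_simps)
    show ?thesis
      using \<open>cmod (ell2_nth (evolution V t (delta 0)) n) \<le> _\<close>
      by (intro order_trans[OF power_mono sq4]) auto
  qed
  have "(\<Sum>n\<in>F. (cmod (ell2_nth (evolution V t (delta 0)) n))\<^sup>2) \<le>
      (\<Sum>n\<in>F. 4 * ((cmod (?I p r n))\<^sup>2 + (cmod (?I r q n))\<^sup>2 + (cmod (?I q s n))\<^sup>2 + (cmod (?I s p n))\<^sup>2))"
    by (intro sum_mono sq)
  also have "\<dots> = 4 * ((\<Sum>n\<in>F. (cmod (?I p r n))\<^sup>2) + (\<Sum>n\<in>F. (cmod (?I r q n))\<^sup>2)
      + (\<Sum>n\<in>F. (cmod (?I q s n))\<^sup>2) + (\<Sum>n\<in>F. (cmod (?I s p n))\<^sup>2))"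
    by (simp only: sum_distrib_left[symmetric] sum.distrib)
  also have "\<dots> \<le> 4 * (4 * K\<^sup>2 * (exp 2 * (4 * (16 / 25) ^ N)) + 4 * K\<^sup>2 * (exp 2 * (4 * (16 / 25) ^ N))
      + 4 * K\<^sup>2 * (exp 2 * (integral {-K..K} G / (2 * K))) + 4 * K\<^sup>2 * (exp 2 * (4 * (16 / 25) ^ N)))"
    by (intro mult_left_mono add_mono side1 side2 side3 side4) simp
  \<comment> \<open>192 = 4 * 3 * 16: the 4 from squaring a sum of four terms, three distant sides,
    and 4 * 4 for each. On the upper side 4 * 4 K^2 / (2 K) = 8 K.\<close>
  also have "\<dots> = exp 2 * (192 * K\<^sup>2 * (16 / 25) ^ N + 8 * K * integral {-K..K} G)"
    using K by (simp add: field_simps power2_eq_square)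
  finally show ?thesis by (simp add: K_def)
qed

lemma outside_probability_le:
  fixes N :: int
  assumes t: "t > 0" and N: "N \<ge> 1" and s: "s = 1 \<or> s = (-1 :: int)"
    and I: "I = (if s = 1 then {0..N - 1} else {-N + 1..0})"
  shows "(\<Sum>\<^sub>\<infinity>n\<in>{n. N \<le> s * n}. (cmod (cinner (evolution V t (delta 0)) (delta n)))\<^sup>2) \<le>
    256 * (a + 1)\<^sup>2 * exp 2 * (exp (- ln (25 / 16) * of_int N) + t ^ 4 *
      integral {-(a + 1)..a + 1} (\<lambda>E. inverse
        (MAX n\<in>I. (matrix_norm (transfer_matrix V n (Complex E (1 / t))))\<^sup>2)))"
    (is "_ \<le> 256 * (a + 1)\<^sup>2 * exp 2 * (_ + t ^ 4 * integral ?J ?g)")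
proof -
  define K where "K = a + 1"
  have K: "K \<ge> 1" using a_nonneg by (simp add: K_def)
  define M where "M = nat N"
  \<comment> \<open>The rate is the squared Combes-Thomas weight: (5/4)^2 = 25/16.\<close>
  have decay: "exp (- ln (25 / 16) * of_int N) = (16 / 25 :: real) ^ M"
  proof -
    have "- ln (25 / 16 :: real) * of_int N = - (of_nat M * ln (25 / 16))"
      using N by (simp add: M_def)
    then have "exp (- ln (25 / 16 :: real) * of_int N) = inverse (exp (ln (25 / 16)) ^ M)"
      by (simp only: exp_minus exp_of_nat_mult)
    also have "\<dots> = (16 / 25) ^ M"
      by (simp flip: power_inverse)
    finally show ?thesis .
  qed
  have I0: "finite I" "0 \<in> I" using I N by auto
  \<comment> \<open>\<open>integral\<close> is 0 on non-integrable functions, so continuity is what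
    gives the right-hand side its intended meaning.\<close>
  have cont: "continuous_on ?J ?g"
  proof (intro continuous_on_inverse ballI)
    have "continuous_on ?J (\<lambda>E. matrix_norm (transfer_matrix V n (Complex E (1 / t))))" for n
      by (rule continuous_on_compose2[OF continuous_on_matrix_norm_transfer[of UNIV]])
         (auto simp: Complex_eq intro!: continuous_intros)
    then show "continuous_on ?J (\<lambda>E. MAX n\<in>I. (matrix_norm (transfer_matrix V n (Complex E (1 / t))))\<^sup>2)"
      using I0 by (intro continuous_on_Max continuous_intros) auto
    fix E
    have "(matrix_norm (transfer_matrix V 0 (Complex E (1 / t))))\<^sup>2
        \<le> (MAX n\<in>I. (matrix_norm (transfer_matrix V n (Complex E (1 / t))))\<^sup>2)"
      using I0 by (intro Max_ge) auto
    then show "(MAX n\<in>I. (matrix_norm (transfer_matrix V n (Complex E (1 / t))))\<^sup>2) \<noteq> 0"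
      by (simp add: transfer_matrix_def matrix_norm_mat_1)
  qed
  have g_nonneg: "0 \<le> ?g E" for E
  proof -
    have "0 \<le> (matrix_norm (transfer_matrix V 0 (Complex E (1 / t))))\<^sup>2" by simp
    also have "\<dots> \<le> (MAX n\<in>I. (matrix_norm (transfer_matrix V n (Complex E (1 / t))))\<^sup>2)"
      using I0 by (intro Max_ge) auto
    finally show ?thesis by simp
  qed
  have int_nonneg: "0 \<le> integral ?J ?g"
    using g_nonneg by (intro integral_nonneg integrable_continuous_real cont) auto
  have KK: "K \<le> K\<^sup>2" using K by (simp add: power2_eq_square)
  have finite_le: "(\<Sum>n\<in>F. (cmod (ell2_nth (evolution V t (delta 0)) n))\<^sup>2) \<le>
      256 * K\<^sup>2 * exp 2 * ((16 / 25) ^ M + t ^ 4 * integral ?J ?g)"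
    if F: "finite F" "F \<subseteq> {n. N \<le> s * n}" for F
  proof -
    have FN: "N \<le> s * n" "int M \<le> \<bar>n\<bar>" if "n \<in> F" for n
      using F(2) that s N by (auto simp: M_def)
    show ?thesis
    proof (cases "t \<ge> 1")
      case True
      let ?G = "\<lambda>E. 8 * t ^ 4 * ?g E"
      have "(\<Sum>n\<in>F. (cmod (ell2_nth (evolution V t (delta 0)) n))\<^sup>2) \<le>
          exp 2 * (192 * K\<^sup>2 * (16 / 25) ^ M + 8 * K * integral ?J ?G)"
        unfolding K_def
      proof (rule sum_evolution_le[OF t, of "1 / t"])
        show "continuous_on ?J ?G" by (intro continuous_intros cont)
        show "(\<Sum>n\<in>F. (cmod (green (Complex E (1 / t)) n))\<^sup>2) \<le> ?G E" for E
          using green_tail_transfer[of "Complex E (1 / t)" "1 / t", OF _ _ _ s F(1) FN(1) I N] t True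
          by (simp add: power_divide)
      qed (use True F(1) FN in auto)
      also have "integral ?J ?G = 8 * (t ^ 4 * integral ?J ?g)"
        by (simp add: mult.assoc)
      also have "exp 2 * (192 * K\<^sup>2 * (16 / 25) ^ M + 8 * K * (8 * (t ^ 4 * integral ?J ?g)))
          \<le> exp 2 * (256 * K\<^sup>2 * (16 / 25) ^ M + 256 * K\<^sup>2 * (t ^ 4 * integral ?J ?g))"
      proof (intro mult_left_mono add_mono)
        have "8 * K * (8 * (t ^ 4 * integral ?J ?g)) = 64 * K * (t ^ 4 * integral ?J ?g)" by simp
        also have "\<dots> \<le> 256 * K\<^sup>2 * (t ^ 4 * integral ?J ?g)"
          using KK K int_nonneg t by (intro mult_right_mono) auto
        finally show "8 * K * (8 * (t ^ 4 * integral ?J ?g)) \<le> 256 * K\<^sup>2 * (t ^ 4 * integral ?J ?g)" .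
      qed auto
      finally show ?thesis by (simp add: algebra_simps)
    next
      case False
      \<comment> \<open>Height 1 satisfies t h <= 1 because t < 1, and it puts the upper side at
        distance 1 from the spectrum like the other three.\<close>
      have "(\<Sum>n\<in>F. (cmod (ell2_nth (evolution V t (delta 0)) n))\<^sup>2) \<le>
          exp 2 * (192 * K\<^sup>2 * (16 / 25) ^ M + 8 * K * integral {-(a + 1)..a + 1} (\<lambda>E. 4 * (16 / 25) ^ M))"
        unfolding K_def
      proof (rule sum_evolution_le[OF t, of 1])
        show "(\<Sum>n\<in>F. (cmod (green (Complex E 1) n))\<^sup>2) \<le> 4 * (16 / 25) ^ M" for E
        proof (rule green_decay)
          show "Complex E 1 \<in> off_spectrum" by (auto simp: off_spectrum_def complex_eq_iff)
          show "1 \<le> cmod (of_real b - Complex E 1)" for b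
            using abs_Im_le_cmod[of "of_real b - Complex E 1"] by simp
        qed (use F(1) FN in auto)
      qed (use False F(1) FN in auto)
      \<comment> \<open>The constant \<open>G\<close> integrates to 8 K (16/25)^M over length 2 K,
        so the upper side adds 64 K^2 to 192 K^2. This fixes 256; the case t >= 1 only asks for 64 K
        there.\<close>
      also have "\<dots> = 256 * K\<^sup>2 * exp 2 * (16 / 25) ^ M"
        using a_nonneg by (simp add: K_def power2_eq_square algebra_simps)
      also have "\<dots> \<le> 256 * K\<^sup>2 * exp 2 * ((16 / 25) ^ M + t ^ 4 * integral ?J ?g)"
        using int_nonneg t by (intro mult_left_mono) auto
      finally show ?thesis .
    qed
  qed
  show ?thesis
    unfolding cinner_delta_right complex_mod_cnj decay K_def[symmetric]
    by (rule infsum_le_finite_sums[OF summable_on_ell2]) (use finite_le in \<open>auto simp: K_def\<close>)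
qed

end

theorem theorem1:
  fixes K :: real
  assumes "K \<ge> 4"
  shows "\<exists>C c :: real. C > 0 \<and> c > 0 \<and>
    (\<forall>V :: int \<Rightarrow> real. bounded (range V) \<longrightarrow>
       op_spectrum (schroedinger V) \<subseteq> complex_of_real ` {-K + 1..K - 1} \<longrightarrow>
       (\<forall>N :: int. \<forall>t :: real. N \<ge> 1 \<longrightarrow> t > 0 \<longrightarrow>
          prob_right V N t \<le> C * (exp (- c * of_int N) + t ^ 4 *
            integral {-K..K} (\<lambda>E. inverse
              (MAX n\<in>{0..N - 1}. (matrix_norm (transfer_matrix V n (Complex E (1 / t))))\<^sup>2))) \<and>
          prob_left V N t \<le> C * (exp (- c * of_int N) + t ^ 4 *
            integral {-K..K} (\<lambda>E. inverse
              (MAX n\<in>{-N + 1..0}. (matrix_norm (transfer_matrix V n (Complex E (1 / t))))\<^sup>2)))))"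
proof (rule exI[of _ "256 * K\<^sup>2 * exp 2"], rule exI[of _ "ln (25 / 16)"], intro conjI allI impI)
  show "256 * K\<^sup>2 * exp 2 > 0" "ln (25 / 16) > (0 :: real)"
    using assms by auto
  fix V :: "int \<Rightarrow> real" and N :: int and t :: real
  assume "bounded (range V)" "op_spectrum (schroedinger V) \<subseteq> complex_of_real ` {-K + 1..K - 1}"
    and N: "N \<ge> 1" and t: "t > 0"
  \<comment> \<open>With a = K - 1 the upper side lies exactly over [-K, K], the range of
    integration in the claim.\<close>
  then interpret bounded_schroedinger V "K - 1"
    using assms by unfold_locales auto
  have "{n. N \<le> 1 * n} = {N..}" "{n. N \<le> -1 * n} = {..-N}"
    by auto
  then show "prob_right V N t \<le> 256 * K\<^sup>2 * exp 2 * (exp (- ln (25 / 16) * of_int N) + t ^ 4 *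
            integral {-K..K} (\<lambda>E. inverse
              (MAX n\<in>{0..N - 1}. (matrix_norm (transfer_matrix V n (Complex E (1 / t))))\<^sup>2)))"
    and "prob_left V N t \<le> 256 * K\<^sup>2 * exp 2 * (exp (- ln (25 / 16) * of_int N) + t ^ 4 *
            integral {-K..K} (\<lambda>E. inverse
              (MAX n\<in>{-N + 1..0}. (matrix_norm (transfer_matrix V n (Complex E (1 / t))))\<^sup>2)))"
    using outside_probability_le[OF t N, of 1] outside_probability_le[OF t N, of "-1"]
    by (simp_all add: prob_right_def prob_left_def)
qed

end
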